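(* In a sharp theory with purification, for every system $\mathrm{A}$ there exists a bijection $\dagger$ from the set of normalized pure states of $\mathrm{A}$ to the set of normalized pure effects of $\mathrm{A}$ such that $(\alpha^\dagger|\alpha)=1$ for every normalized pure state $\alpha$ of $\mathrm{A}$.
   Context: Setting: an operational-probabilistic theory (general probabilistic theory in the circuit framework). It has systems with a symmetric associative composition $\otimes$ and a trivial system $\mathrm{I}$ ($\mathrm{I}\otimes\mathrm{A}=\mathrm{A}$). Transformations between systems are closed under sequential and parallel composition. States of $\mathrm{A}$ are transformations $\mathrm{I}\to\mathrm{A}$, effects are transformations $\mathrm{A}\to\mathrm{I}$, and a state $\rho$ followed by an effect $a$ gives a probability $(a|\rho)\in[0,1]$. Tests are theory-specified collections of transformations representing alternative outcomes of one experiment (observation-tests: tests made of effects); single-outcome tests are channels. States and effects span finite-dimensional real vector spaces; all sets of transformations are convex and compact. A transformation $\mathcal C$ is pure if whenever $\mathcal C=\sum_j\mathcal D_j$ with $\{\mathcal D_j\}$ outcomes of a test, each $\mathcal D_j=p_j\mathcal C$, $p_j\ge0$. A channel is reversible if it has an inverse channel. Every test can be realized as a channel followed by an observation-test on an auxiliary output. A sharp theory with purification satisfies: (Causality) every system has a unique deterministic effect $u_\mathrm{A}$, observation-tests sum to $u_\mathrm{A}$, marginals are $\mathrm{Tr}_\mathrm{B}\rho_{\mathrm{AB}}:=(\mathcal I_\mathrm{A}\otimes u_\mathrm{B})\rho_{\mathrm{AB}}$, and $\rho$ is normalized if $(u_\mathrm{A}|\rho)=1$; an effect $a$ is normalized if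 $\sup_\rho(a|\rho)=1$ over normalized states; (Purity Preservation) sequential and parallel compositions of pure transformations are pure; (Pure Sharpness) every system has a pure effect $a$ with $(a|\rho)=1$ for some state $\rho$; (Purification) every normalized state $\rho$ of $\mathrm{A}$ has a purification, a pure normalized state $\Psi$ of some $\mathrm{A}\otimes\mathrm{B}$ with $\mathrm{Tr}_\mathrm{B}\Psi=\rho$, and two purifications with the same purifying system $\mathrm{B}$ differ by a reversible channel on $\mathrm{B}$. *)

theory Defs
  imports "HOL-Analysis.Analysis"
begin

text \<open>
  An OPT is rendered as a record.  Systems have an arbitrary type 's; all
  transformations (between all pairs of systems) live in one real normed vector
  space 't, and the transformations from A to B form the subset
  transf T A B.  Sums / scalar multiples of transformations are the vector
  operations (coarse-graining / rescaling).  Tests are finite lists of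
  transformations (the outcomes).  seqc T g f is g after f (sequential
  composition), parc T f g is the parallel composition f tensor g, ident T A the
  identity of A, swap T A B the symmetry channel of A tensor B.
\<close>

record ('s, 't) opt =
  tensor :: "'s \<Rightarrow> 's \<Rightarrow> 's"
  triv   :: 's
  transf :: "'s \<Rightarrow> 's \<Rightarrow> 't set"
  tests  :: "'s \<Rightarrow> 's \<Rightarrow> 't list set"
  seqc   :: "'t \<Rightarrow> 't \<Rightarrow> 't"
  parc   :: "'t \<Rightarrow> 't \<Rightarrow> 't"
  ident  :: "'s \<Rightarrow> 't"
  swap   :: "'s \<Rightarrow> 's \<Rightarrow> 't"

definition states :: "('s, 't) opt \<Rightarrow> 's \<Rightarrow> 't set" where
  "states T A = transf T (triv T) A"

definition effects :: "('s, 't) opt \<Rightarrow> 's \<Rightarrow> 't set" where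
  "effects T A = transf T A (triv T)"

text \<open>Transformations I to I are probabilities p, identified with p times the identity of I.\<close>
definition scal :: "('s, 't::real_vector) opt \<Rightarrow> 't \<Rightarrow> real" where
  "scal T x = (THE p. x = p *\<^sub>R ident T (triv T))"

definition pr :: "('s, 't::real_vector) opt \<Rightarrow> 't \<Rightarrow> 't \<Rightarrow> real" where
  "pr T a \<rho> = scal T (seqc T a \<rho>)"

definition channels :: "('s, 't) opt \<Rightarrow> 's \<Rightarrow> 's \<Rightarrow> 't set" where
  "channels T A B = {C. [C] \<in> tests T A B}"

definition reversible :: "('s, 't) opt \<Rightarrow> 's \<Rightarrow> 's \<Rightarrow> 't \<Rightarrow> bool" where
  "reversible T A B C \<longleftrightarrow> C \<in> channels T A B \<and>
     (\<exists>D \<in> channels T B A. seqc T D C = ident T A \<and> seqc T C D = ident T B)"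

definition pure :: "('s, 't::real_vector) opt \<Rightarrow> 's \<Rightarrow> 's \<Rightarrow> 't \<Rightarrow> bool" where
  "pure T A B C \<longleftrightarrow> C \<in> transf T A B \<and>
     (\<forall>Ds \<in> tests T A B. \<forall>J \<subseteq> {..<length Ds}.
        C = (\<Sum>j\<in>J. Ds ! j) \<longrightarrow> (\<forall>j\<in>J. \<exists>p\<ge>0. Ds ! j = p *\<^sub>R C))"

definition is_opt :: "('s, 't::real_normed_vector) opt \<Rightarrow> bool" where
  "is_opt T \<longleftrightarrow>
   \<comment> \<open>systems: associative composition with unit\<close>
   (\<forall>A B C. tensor T (tensor T A B) C = tensor T A (tensor T B C)) \<and>
   (\<forall>A. tensor T (triv T) A = A \<and> tensor T A (triv T) = A) \<and>
   \<comment> \<open>transformations: convex, compact, finite-dimensional; hom-spaces in direct sum\<close>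
   (\<forall>A B. convex (transf T A B) \<and> compact (transf T A B) \<and>
          (\<exists>S. finite S \<and> transf T A B \<subseteq> span S)) \<and>
   (\<forall>A B A' B'. (A, B) \<noteq> (A', B') \<longrightarrow>
          span (transf T A B) \<inter> span (transf T A' B') \<subseteq> {0}) \<and>
   \<comment> \<open>tests are nonempty finite collections of transformations; every transformation belongs to a test\<close>
   (\<forall>A B. \<forall>Ts \<in> tests T A B. Ts \<noteq> [] \<and> set Ts \<subseteq> transf T A B) \<and>
   (\<forall>A B. \<forall>C \<in> transf T A B. \<exists>Ts \<in> tests T A B. C \<in> set Ts) \<and>
   \<comment> \<open>closure under sequential and parallel composition\<close>
   (\<forall>A B C. \<forall>Fs \<in> tests T A B. \<forall>Gs \<in> tests T B C.
        [seqc T g f. f \<leftarrow> Fs, g \<leftarrow> Gs] \<in> tests T A C) \<and>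
   (\<forall>A B C D. \<forall>Fs \<in> tests T A B. \<forall>Gs \<in> tests T C D.
        [parc T f g. f \<leftarrow> Fs, g \<leftarrow> Gs] \<in> tests T (tensor T A C) (tensor T B D)) \<and>
   (\<forall>A. ident T A \<in> channels T A A) \<and>
   \<comment> \<open>category laws\<close>
   (\<forall>A B C D f g h. f \<in> transf T A B \<longrightarrow> g \<in> transf T B C \<longrightarrow> h \<in> transf T C D \<longrightarrow>
        seqc T h (seqc T g f) = seqc T (seqc T h g) f) \<and>
   (\<forall>A B f. f \<in> transf T A B \<longrightarrow> seqc T (ident T B) f = f \<and> seqc T f (ident T A) = f) \<and>
   (\<forall>A B. ident T (tensor T A B) = parc T (ident T A) (ident T B)) \<and>
   (\<forall>A B C A' B' C' f f' g g'. f \<in> transf T A B \<longrightarrow> f' \<in> transf T B C \<longrightarrow>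
        g \<in> transf T A' B' \<longrightarrow> g' \<in> transf T B' C' \<longrightarrow>
        parc T (seqc T f' f) (seqc T g' g) = seqc T (parc T f' g') (parc T f g)) \<and>
   (\<forall>A B C D E F f g h. f \<in> transf T A B \<longrightarrow> g \<in> transf T C D \<longrightarrow> h \<in> transf T E F \<longrightarrow>
        parc T (parc T f g) h = parc T f (parc T g h)) \<and>
   \<comment> \<open>symmetry\<close>
   (\<forall>A B. swap T A B \<in> channels T (tensor T A B) (tensor T B A) \<and>
          seqc T (swap T B A) (swap T A B) = ident T (tensor T A B)) \<and>
   (\<forall>A B C D f g. f \<in> transf T A C \<longrightarrow> g \<in> transf T B D \<longrightarrow>
        seqc T (swap T C D) (parc T f g) = seqc T (parc T g f) (swap T A B)) \<and>
   \<comment> \<open>bilinearity of the compositions (on the spanned vector spaces)\<close>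
   (\<forall>A B C x y z c. x \<in> span (transf T A B) \<longrightarrow> y \<in> span (transf T A B) \<longrightarrow>
        z \<in> span (transf T B C) \<longrightarrow>
        seqc T z (x + y) = seqc T z x + seqc T z y \<and> seqc T z (c *\<^sub>R x) = c *\<^sub>R seqc T z x) \<and>
   (\<forall>A B C x y z c. x \<in> span (transf T B C) \<longrightarrow> y \<in> span (transf T B C) \<longrightarrow>
        z \<in> span (transf T A B) \<longrightarrow>
        seqc T (x + y) z = seqc T x z + seqc T y z \<and> seqc T (c *\<^sub>R x) z = c *\<^sub>R seqc T x z) \<and>
   (\<forall>A B C D x y z c. x \<in> span (transf T A B) \<longrightarrow> y \<in> span (transf T A B) \<longrightarrow>
        z \<in> span (transf T C D) \<longrightarrow>
        parc T z (x + y) = parc T z x + parc T z y \<and> parc T z (c *\<^sub>R x) = c *\<^sub>R parc T z x \<and>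
        parc T (x + y) z = parc T x z + parc T y z \<and> parc T (c *\<^sub>R x) z = c *\<^sub>R parc T x z) \<and>
   \<comment> \<open>the trivial system: transformations I to I are the probabilities\<close>
   ident T (triv T) \<noteq> 0 \<and>
   transf T (triv T) (triv T) = {p *\<^sub>R ident T (triv T) | p. 0 \<le> p \<and> p \<le> 1} \<and>
   (\<forall>A B p f. p \<in> transf T (triv T) (triv T) \<longrightarrow> f \<in> transf T A B \<longrightarrow>
        parc T p f = scal T p *\<^sub>R f \<and> parc T f p = scal T p *\<^sub>R f) \<and>
   \<comment> \<open>operational equivalence: vectors are identified by the probabilities they produce\<close>
   (\<forall>A B x y. x \<in> span (transf T A B) \<longrightarrow> y \<in> span (transf T A B) \<longrightarrow>
        (\<forall>E. \<forall>\<rho> \<in> states T (tensor T A E). \<forall>b \<in> effects T (tensor T B E).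
            pr T b (seqc T (parc T x (ident T E)) \<rho>) = pr T b (seqc T (parc T y (ident T E)) \<rho>))
        \<longrightarrow> x = y) \<and>
   \<comment> \<open>every test is a channel followed by an observation-test on an auxiliary output\<close>
   (\<forall>A B. \<forall>Ts \<in> tests T A B. \<exists>E C es.
        C \<in> channels T A (tensor T B E) \<and> es \<in> tests T E (triv T) \<and>
        length es = length Ts \<and>
        (\<forall>i < length Ts. Ts ! i = seqc T (parc T (ident T B) (es ! i)) C))"

text \<open>The deterministic effect u_A (unique under Causality).\<close>
definition det_eff :: "('s, 't) opt \<Rightarrow> 's \<Rightarrow> 't" where
  "det_eff T A = (THE u. u \<in> channels T A (triv T))"

definition marginal :: "('s, 't) opt \<Rightarrow> 's \<Rightarrow> 's \<Rightarrow> 't \<Rightarrow> 't" where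
  "marginal T A B \<Psi> = seqc T (parc T (ident T A) (det_eff T B)) \<Psi>"

definition normalized_states :: "('s, 't::real_vector) opt \<Rightarrow> 's \<Rightarrow> 't set" where
  "normalized_states T A = {\<rho> \<in> states T A. pr T (det_eff T A) \<rho> = 1}"

definition normalized_effects :: "('s, 't::real_vector) opt \<Rightarrow> 's \<Rightarrow> 't set" where
  "normalized_effects T A =
     {a \<in> effects T A. (SUP \<rho> \<in> normalized_states T A. pr T a \<rho>) = 1}"

definition causal :: "('s, 't::real_vector) opt \<Rightarrow> bool" where
  "causal T \<longleftrightarrow> (\<forall>A. (\<exists>!u. u \<in> channels T A (triv T)) \<and>
      (\<forall>es \<in> tests T A (triv T). sum_list es = det_eff T A))"

definition purity_preservation :: "('s, 't::real_vector) opt \<Rightarrow> bool" where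
  "purity_preservation T \<longleftrightarrow>
     (\<forall>A B C f g. pure T A B f \<longrightarrow> pure T B C g \<longrightarrow> pure T A C (seqc T g f)) \<and>
     (\<forall>A B C D f g. pure T A B f \<longrightarrow> pure T C D g \<longrightarrow>
        pure T (tensor T A C) (tensor T B D) (parc T f g))"

definition pure_sharpness :: "('s, 't::real_vector) opt \<Rightarrow> bool" where
  "pure_sharpness T \<longleftrightarrow>
     (\<forall>A. \<exists>a \<rho>. pure T A (triv T) a \<and> \<rho> \<in> states T A \<and> pr T a \<rho> = 1)"

definition is_purification :: "('s, 't::real_vector) opt \<Rightarrow> 's \<Rightarrow> 's \<Rightarrow> 't \<Rightarrow> 't \<Rightarrow> bool" where
  "is_purification T A B \<rho> \<Psi> \<longleftrightarrow>
     pure T (triv T) (tensor T A B) \<Psi> \<and> \<Psi> \<in> normalized_states T (tensor T A B) \<and>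
     marginal T A B \<Psi> = \<rho>"

definition purification :: "('s, 't::real_vector) opt \<Rightarrow> bool" where
  "purification T \<longleftrightarrow>
     (\<forall>A. \<forall>\<rho> \<in> normalized_states T A.
        (\<exists>B \<Psi>. is_purification T A B \<rho> \<Psi>) \<and>
        (\<forall>B \<Psi> \<Psi>'. is_purification T A B \<rho> \<Psi> \<longrightarrow> is_purification T A B \<rho> \<Psi>' \<longrightarrow>
           (\<exists>U. reversible T B B U \<and> \<Psi>' = seqc T (parc T (ident T A) U) \<Psi>)))"

definition sharp_theory_with_purification :: "('s, 't::real_normed_vector) opt \<Rightarrow> bool" where
  "sharp_theory_with_purification T \<longleftrightarrow>
     is_opt T \<and> causal T \<and> purity_preservation T \<and> pure_sharpness T \<and> purification T"

definition pure_normalized_states :: "('s, 't::real_vector) opt \<Rightarrow> 's \<Rightarrow> 't set" where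
  "pure_normalized_states T A = {\<alpha> \<in> normalized_states T A. pure T (triv T) A \<alpha>}"

definition pure_normalized_effects :: "('s, 't::real_vector) opt \<Rightarrow> 's \<Rightarrow> 't set" where
  "pure_normalized_effects T A = {a \<in> normalized_effects T A. pure T A (triv T) a}"

end

theory Submission
  imports Defs
begin

text \<open>
  If a pure effect \<open>a\<close> has probability 1 on \<open>\<rho>\<close>, applying it to one half of a purification of \<open>\<rho>\<close> leaves
  the other marginal unchanged and pure, so uniqueness of purification makes \<open>\<rho>\<close> pure.  Pure states are
  extremal, hence \<open>a\<close> has probability 1 on a single state.

  Conversely, let \<open>a1\<close>, \<open>a2\<close> be pure effects with probability 1 on \<open>\<alpha>\<close>.  Feed \<open>\<alpha> \<otimes> \<gamma>\<close> into a pure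
  dilation of a random swap of two copies of the system whose two branches are marked by different
  states.  As \<open>u - a1\<close> and \<open>u - a2\<close> vanish on \<open>\<alpha>\<close>, the outcomes \<open>a1 \<otimes> a2\<close> and \<open>a2 \<otimes> a1\<close> together
  leave the environment in the same state as \<open>a1 \<otimes> a1\<close> and \<open>a2 \<otimes> a2\<close> together.  That state is a multiple of
  one pure state, because the pure effects \<open>a1 \<otimes> a1\<close> and \<open>a2 \<otimes> a2\<close> are swap invariant.  By extremality each
  mixed outcome gives a multiple of it too, so the two branches have equal weights for \<open>a1 \<otimes> a2\<close>, which
  says that \<open>a1\<close> and \<open>a2\<close> have equal probabilities on \<open>\<gamma>\<close>.  No renormalisation of the states left by an
  outcome is used; it is not available here, since a multiple of a state need not be a state.
\<close>

subsection \<open>Linear functionals on finite-dimensional spans\<close>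

lemma norm_coordinate_bound:
  fixes B :: "'a::real_normed_vector set"
  assumes cl: "closed (span B)" and v: "v \<notin> span B"
  obtains d where "d > 0" "\<And>w t. w \<in> span B \<Longrightarrow> \<bar>t\<bar> * d \<le> norm (w + t *\<^sub>R v)"
proof -
  obtain d where d: "d > 0" "\<And>y. dist y v < d \<Longrightarrow> y \<notin> span B"
  proof -
    have "open (- span B)" using cl by (rule open_Compl)
    then show thesis using v that unfolding open_dist by blast
  qed
  have bd: "\<bar>t\<bar> * d \<le> norm (w + t *\<^sub>R v)" if w: "w \<in> span B" for w t
  proof (cases "t = 0")
    case False
    have "- (1/t) *\<^sub>R w \<in> span B" using w by (rule span_scale)
    then have "d \<le> norm (- (1/t) *\<^sub>R w - v)" using d(2)[of "- (1/t) *\<^sub>R w"] by (fastforce simp: dist_norm not_less[symmetric])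
    also have "- (1/t) *\<^sub>R w - v = (- (1/t)) *\<^sub>R (w + t *\<^sub>R v)" using False by (simp add: algebra_simps)
    also have "norm \<dots> = norm (w + t *\<^sub>R v) / \<bar>t\<bar>" by simp
    finally show ?thesis using False by (simp add: field_simps)
  qed simp
  with d(1) show thesis by (rule that)
qed

lemma complete_span_finite:
  fixes B :: "'a::real_normed_vector set"
  assumes "finite B"
  shows "complete (span B)"
  using assms
proof (induction B rule: finite_induct)
  case empty
  show ?case by (simp add: compact_imp_complete)
next
  case (insert v B)
  show ?case
  proof (cases "v \<in> span B")
    case True
    then show ?thesis using insert.IH by (simp add: span_redundant)
  next
    case False
    obtain d where d: "d > 0" and bd: "\<And>w t. w \<in> span B \<Longrightarrow> \<bar>t\<bar> * d \<le> norm (w + t *\<^sub>R v)"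
      using norm_coordinate_bound[OF complete_imp_closed[OF insert.IH] False] by blast
    show ?thesis
      unfolding complete_def
    proof (intro allI impI, elim conjE)
      fix x :: "nat \<Rightarrow> 'a"
      assume x: "\<forall>n. x n \<in> span (insert v B)" and C: "Cauchy x"
      have ex: "\<forall>n. \<exists>t. x n - t *\<^sub>R v \<in> span B" using x by (simp add: span_breakdown_eq)
      then obtain t where t: "\<And>n. x n - t n *\<^sub>R v \<in> span B" using choice[OF ex] by blast
      define w where "w n = x n - t n *\<^sub>R v" for n
      have w: "w n \<in> span B" "x n = w n + t n *\<^sub>R v" for n using t by (auto simp: w_def)
      have td: "\<bar>t m - t n\<bar> * d \<le> norm (x m - x n)" for m n
      proof -
        have "w m - w n \<in> span B" using w by (simp add: span_diff)
        from bd[OF this, of "t m - t n"] show ?thesis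
          using w(2)[of m] w(2)[of n] by (simp add: algebra_simps)
      qed
      have "Cauchy t"
      proof (rule CauchyI)
        fix e :: real assume e: "e > 0"
        then obtain M where M: "\<And>m n. m \<ge> M \<Longrightarrow> n \<ge> M \<Longrightarrow> norm (x m - x n) < e * d"
          using CauchyD[OF C, of "e * d"] d by auto
        have "norm (t m - t n) < e" if "m \<ge> M" "n \<ge> M" for m n
        proof -
          have "\<bar>t m - t n\<bar> * d < e * d" using td[of m n] M[OF that] by linarith
          then show ?thesis using d by (simp add: mult_less_cancel_right)
        qed
        then show "\<exists>M. \<forall>m\<ge>M. \<forall>n\<ge>M. norm (t m - t n) < e" by blast
      qed
      then obtain t0 where t0: "t \<longlonglongrightarrow> t0" by (auto simp: Cauchy_convergent_iff convergent_def)
      have "Cauchy w"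
      proof -
        have tv: "Cauchy (\<lambda>n. t n *\<^sub>R v)"
          using tendsto_scaleR[OF t0 tendsto_const] by (rule LIMSEQ_imp_Cauchy)
        show ?thesis
        proof (rule CauchyI)
          fix e :: real assume "e > 0"
          then have e: "e / 2 > 0" by simp
          obtain M where M: "\<And>m n. m \<ge> M \<Longrightarrow> n \<ge> M \<Longrightarrow> norm (x m - x n) < e / 2"
            using CauchyD[OF C e] by blast
          obtain N where N: "\<And>m n. m \<ge> N \<Longrightarrow> n \<ge> N \<Longrightarrow> norm (t m *\<^sub>R v - t n *\<^sub>R v) < e / 2"
            using CauchyD[OF tv e] by blast
          have "norm (w m - w n) < e" if "m \<ge> max M N" "n \<ge> max M N" for m n
          proof -
            have "w m - w n = (x m - x n) - (t m *\<^sub>R v - t n *\<^sub>R v)" by (simp add: w_def)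
            then have "norm (w m - w n) \<le> norm (x m - x n) + norm (t m *\<^sub>R v - t n *\<^sub>R v)"
              by (simp only: norm_triangle_ineq4)
            then show ?thesis using M[of m n] N[of m n] that by auto
          qed
          then show "\<exists>M. \<forall>m\<ge>M. \<forall>n\<ge>M. norm (w m - w n) < e" by blast
        qed
      qed
      then obtain w0 where w0: "w0 \<in> span B" "w \<longlonglongrightarrow> w0"
        using insert.IH w(1) unfolding complete_def by blast
      have "x \<longlonglongrightarrow> w0 + t0 *\<^sub>R v"
        using tendsto_add[OF w0(2) tendsto_scaleR[OF t0 tendsto_const[of v]]]
        by (simp only: w(2)[symmetric])
      moreover have "w0 + t0 *\<^sub>R v \<in> span (insert v B)"
        using w0(1) unfolding span_breakdown_eq by (metis add_diff_cancel_right')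
      ultimately show "\<exists>l\<in>span (insert v B). x \<longlonglongrightarrow> l" by blast
    qed
  qed
qed

lemma linear_functional_bounded_on_finite_span:
  fixes B :: "'a::real_normed_vector set" and f :: "'a \<Rightarrow> real"
  assumes "finite B"
    and "\<And>x y. x \<in> span B \<Longrightarrow> y \<in> span B \<Longrightarrow> f (x + y) = f x + f y"
    and "\<And>c x. x \<in> span B \<Longrightarrow> f (c *\<^sub>R x) = c * f x"
  shows "\<exists>C\<ge>0. \<forall>x\<in>span B. \<bar>f x\<bar> \<le> C * norm x"
  using assms
proof (induction B rule: finite_induct)
  case empty
  have "f 0 = 0" using empty(2)[of 0 0] by (simp add: span_zero)
  then show ?case by (intro exI[of _ 0]) simp
next
  case (insert v B)
  have sub: "span B \<subseteq> span (insert v B)" by (rule span_mono) auto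
  have v: "v \<in> span (insert v B)" by (simp add: span_base)
  obtain C where C: "C \<ge> 0" "\<And>x. x \<in> span B \<Longrightarrow> \<bar>f x\<bar> \<le> C * norm x"
  proof -
    have "\<exists>C\<ge>0. \<forall>x\<in>span B. \<bar>f x\<bar> \<le> C * norm x"
    proof (rule insert.IH)
      show "f (x + y) = f x + f y" if "x \<in> span B" "y \<in> span B" for x y
        using insert.prems(1) that sub by blast
      show "f (c *\<^sub>R x) = c * f x" if "x \<in> span B" for c x
        using insert.prems(2) that sub by blast
    qed
    then show thesis using that by blast
  qed
  show ?case
  proof (cases "v \<in> span B")
    case True
    then show ?thesis using C by (auto simp: span_redundant)
  next
    case False
    obtain d where d: "d > 0" and bd: "\<And>w t. w \<in> span B \<Longrightarrow> \<bar>t\<bar> * d \<le> norm (w + t *\<^sub>R v)"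
      using norm_coordinate_bound[OF complete_imp_closed[OF complete_span_finite[OF insert(1)]] False] by blast
    show ?thesis
    proof (intro exI[of _ "C + (C * norm v + \<bar>f v\<bar>) / d"] conjI ballI)
      show "0 \<le> C + (C * norm v + \<bar>f v\<bar>) / d" using C d by simp
      fix x assume "x \<in> span (insert v B)"
      then obtain t where t: "x - t *\<^sub>R v \<in> span B" by (auto simp: span_breakdown_eq)
      define w where "w = x - t *\<^sub>R v"
      have x: "x = w + t *\<^sub>R v" and w: "w \<in> span B" using t by (auto simp: w_def)
      have tb: "\<bar>t\<bar> \<le> norm x / d" using bd[OF w, of t] d x by (simp add: field_simps)
      have "f x = f w + t * f v"
        using insert.prems(1)[of w "t *\<^sub>R v"] insert.prems(2)[OF v] w sub v x by (auto simp: span_scale)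
      moreover have nw: "norm w \<le> norm x + \<bar>t\<bar> * norm v"
        using norm_triangle_ineq4[of x "t *\<^sub>R v"] by (simp add: w_def)
      ultimately have "\<bar>f x\<bar> \<le> \<bar>f w\<bar> + \<bar>t\<bar> * \<bar>f v\<bar>" using abs_triangle_ineq[of "f w" "t * f v"] by (simp add: abs_mult)
      also have "\<bar>f w\<bar> \<le> C * (norm x + \<bar>t\<bar> * norm v)"
        using C(2)[OF w] mult_left_mono[OF nw C(1)] by linarith
      finally have "\<bar>f x\<bar> \<le> C * norm x + \<bar>t\<bar> * (C * norm v + \<bar>f v\<bar>)"
        by (simp add: algebra_simps)
      also have "\<dots> \<le> C * norm x + (norm x / d) * (C * norm v + \<bar>f v\<bar>)"
        using tb C(1) by (intro add_left_mono mult_right_mono) auto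
      finally show "\<bar>f x\<bar> \<le> (C + (C * norm v + \<bar>f v\<bar>) / d) * norm x"
        by (simp add: algebra_simps add_divide_distrib)
    qed
  qed
qed

subsection \<open>States, effects and tests\<close>

locale sharp_purification_theory =
  fixes T :: "('s, 't::real_normed_vector) opt"
  assumes sharp: "sharp_theory_with_purification T"
begin

abbreviation sys_tensor :: "'s \<Rightarrow> 's \<Rightarrow> 's" (infixr "\<star>" 75) where "A \<star> B \<equiv> tensor T A B"
abbreviation seq_comp :: "'t \<Rightarrow> 't \<Rightarrow> 't" (infixr "\<odot>" 70) where "g \<odot> f \<equiv> seqc T g f"
abbreviation par_comp :: "'t \<Rightarrow> 't \<Rightarrow> 't" (infixr "\<otimes>" 75) where "f \<otimes> g \<equiv> parc T f g"
abbreviation hom :: "'s \<Rightarrow> 's \<Rightarrow> 't set" where "hom \<equiv> transf T"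
abbreviation I :: 's where "I \<equiv> triv T"
abbreviation idn :: "'s \<Rightarrow> 't" where "idn \<equiv> ident T"
abbreviation u :: "'s \<Rightarrow> 't" where "u \<equiv> det_eff T"
abbreviation nst :: "'s \<Rightarrow> 't set" where "nst \<equiv> normalized_states T"
abbreviation ev :: "'t \<Rightarrow> 't \<Rightarrow> real" where "ev \<equiv> pr T"

lemma is_opt: "is_opt T" and causal: "causal T" and purity: "purity_preservation T"
  and sharpness: "pure_sharpness T" and purif: "purification T"
  using sharp by (auto simp: sharp_theory_with_purification_def)

lemma sys_assoc: "\<forall>A B C. (A \<star> B) \<star> C = A \<star> (B \<star> C)"
  using is_opt unfolding is_opt_def by (elim conjE)
lemma sys_unit: "\<forall>A. I \<star> A = A \<and> A \<star> I = A"
  using is_opt unfolding is_opt_def by (elim conjE)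
lemmas sys_simps [simp] = sys_assoc[rule_format] sys_unit[rule_format, THEN conjunct1] sys_unit[rule_format, THEN conjunct2]

lemma hom_convex_compact [rule_format]: "\<forall>A B. convex (hom A B) \<and> compact (hom A B) \<and>
    (\<exists>S. finite S \<and> hom A B \<subseteq> span S)"
  using is_opt unfolding is_opt_def by (elim conjE)
lemma tests_hom [rule_format]: "\<forall>A B. \<forall>Ts \<in> tests T A B. Ts \<noteq> [] \<and> set Ts \<subseteq> hom A B"
  using is_opt unfolding is_opt_def by (elim conjE)
lemma hom_in_test [rule_format]: "\<forall>A B. \<forall>C \<in> hom A B. \<exists>Ts \<in> tests T A B. C \<in> set Ts"
  using is_opt unfolding is_opt_def by (elim conjE)
lemma tests_seq [rule_format]: "\<forall>A B C. \<forall>Fs \<in> tests T A B. \<forall>Gs \<in> tests T B C.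
    [seqc T g f. f \<leftarrow> Fs, g \<leftarrow> Gs] \<in> tests T A C"
  using is_opt unfolding is_opt_def by (elim conjE)
lemma tests_par [rule_format]: "\<forall>A B C D. \<forall>Fs \<in> tests T A B. \<forall>Gs \<in> tests T C D.
    [parc T f g. f \<leftarrow> Fs, g \<leftarrow> Gs] \<in> tests T (A \<star> C) (B \<star> D)"
  using is_opt unfolding is_opt_def by (elim conjE)
lemma ident_channel [rule_format]: "\<forall>A. idn A \<in> channels T A A"
  using is_opt unfolding is_opt_def by (elim conjE)
lemma seq_assoc [rule_format]: "\<forall>A B C D f g h. f \<in> hom A B \<longrightarrow> g \<in> hom B C \<longrightarrow> h \<in> hom C D \<longrightarrow>
    h \<odot> (g \<odot> f) = (h \<odot> g) \<odot> f"
  using is_opt unfolding is_opt_def by (elim conjE)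
lemma seq_unit: "\<forall>A B f. f \<in> hom A B \<longrightarrow> idn B \<odot> f = f \<and> f \<odot> idn A = f"
  using is_opt unfolding is_opt_def by (elim conjE)
lemma ident_tensor: "\<forall>A B. idn (A \<star> B) = idn A \<otimes> idn B"
  using is_opt unfolding is_opt_def by (elim conjE)
lemma interchange [rule_format]: "\<forall>A B C A' B' C' f f' g g'. f \<in> hom A B \<longrightarrow> f' \<in> hom B C \<longrightarrow>
    g \<in> hom A' B' \<longrightarrow> g' \<in> hom B' C' \<longrightarrow> (f' \<odot> f) \<otimes> (g' \<odot> g) = (f' \<otimes> g') \<odot> (f \<otimes> g)"
  using is_opt unfolding is_opt_def by (elim conjE)
lemma par_assoc [rule_format]: "\<forall>A B C D E F f g h. f \<in> hom A B \<longrightarrow> g \<in> hom C D \<longrightarrow> h \<in> hom E F \<longrightarrow>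
    (f \<otimes> g) \<otimes> h = f \<otimes> (g \<otimes> h)"
  using is_opt unfolding is_opt_def by (elim conjE)
lemma swap_channel: "\<forall>A B. swap T A B \<in> channels T (A \<star> B) (B \<star> A) \<and>
    swap T B A \<odot> swap T A B = idn (A \<star> B)"
  using is_opt unfolding is_opt_def by (elim conjE)
lemma swap_natural [rule_format]: "\<forall>A B C D f g. f \<in> hom A C \<longrightarrow> g \<in> hom B D \<longrightarrow>
    swap T C D \<odot> (f \<otimes> g) = (g \<otimes> f) \<odot> swap T A B"
  using is_opt unfolding is_opt_def by (elim conjE)
lemma seq_linear_right: "\<forall>A B C x y z c. x \<in> span (hom A B) \<longrightarrow> y \<in> span (hom A B) \<longrightarrow>
    z \<in> span (hom B C) \<longrightarrow> z \<odot> (x + y) = z \<odot> x + z \<odot> y \<and> z \<odot> (c *\<^sub>R x) = c *\<^sub>R (z \<odot> x)"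
  using is_opt unfolding is_opt_def by (elim conjE)
lemma seq_linear_left: "\<forall>A B C x y z c. x \<in> span (hom B C) \<longrightarrow> y \<in> span (hom B C) \<longrightarrow>
    z \<in> span (hom A B) \<longrightarrow> (x + y) \<odot> z = x \<odot> z + y \<odot> z \<and> (c *\<^sub>R x) \<odot> z = c *\<^sub>R (x \<odot> z)"
  using is_opt unfolding is_opt_def by (elim conjE)
lemma par_bilinear: "\<forall>A B C D x y z c. x \<in> span (hom A B) \<longrightarrow> y \<in> span (hom A B) \<longrightarrow>
    z \<in> span (hom C D) \<longrightarrow>
    z \<otimes> (x + y) = z \<otimes> x + z \<otimes> y \<and> z \<otimes> (c *\<^sub>R x) = c *\<^sub>R (z \<otimes> x) \<and>
    (x + y) \<otimes> z = x \<otimes> z + y \<otimes> z \<and> (c *\<^sub>R x) \<otimes> z = c *\<^sub>R (x \<otimes> z)"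
  using is_opt unfolding is_opt_def by (elim conjE)
lemma ident_triv_nonzero [simp]: "idn I \<noteq> 0"
  using is_opt unfolding is_opt_def by (elim conjE)
lemma hom_triv: "hom I I = {p *\<^sub>R idn I | p. 0 \<le> p \<and> p \<le> 1}"
  using is_opt unfolding is_opt_def by (elim conjE)
lemma par_scalar [rule_format]: "\<forall>A B p f. p \<in> hom I I \<longrightarrow> f \<in> hom A B \<longrightarrow>
    p \<otimes> f = scal T p *\<^sub>R f \<and> f \<otimes> p = scal T p *\<^sub>R f"
  using is_opt unfolding is_opt_def by (elim conjE)
lemma op_equiv: "\<forall>A B x y. x \<in> span (hom A B) \<longrightarrow> y \<in> span (hom A B) \<longrightarrow>
    (\<forall>E. \<forall>\<rho> \<in> states T (A \<star> E). \<forall>b \<in> effects T (B \<star> E).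
        ev b ((x \<otimes> idn E) \<odot> \<rho>) = ev b ((y \<otimes> idn E) \<odot> \<rho>))
    \<longrightarrow> x = y"
  using is_opt unfolding is_opt_def by (elim conjE)
lemma realization [rule_format]: "\<forall>A B. \<forall>Ts \<in> tests T A B. \<exists>E C es.
    C \<in> channels T A (B \<star> E) \<and> es \<in> tests T E I \<and> length es = length Ts \<and>
    (\<forall>i < length Ts. Ts ! i = (idn B \<otimes> (es ! i)) \<odot> C)"
  using is_opt unfolding is_opt_def by (elim conjE)

lemma states_eq [simp]: "states T A = hom I A" and effects_eq [simp]: "effects T A = hom A I"
  by (simp_all add: states_def effects_def)

lemma hom_span: "f \<in> hom A B \<Longrightarrow> f \<in> span (hom A B)"
  by (rule span_base)

lemma channel_test: "C \<in> channels T A B \<Longrightarrow> [C] \<in> tests T A B"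
  by (simp add: channels_def)

lemma channel_hom: "C \<in> channels T A B \<Longrightarrow> C \<in> hom A B"
  using tests_hom[of "[C]" A B] by (simp add: channels_def)

lemma ident_hom [simp]: "idn A \<in> hom A A"
  using ident_channel by (rule channel_hom)

lemma swap_hom [simp]: "swap T A B \<in> hom (A \<star> B) (B \<star> A)"
  using swap_channel by (blast intro: channel_hom)

lemma ident_seq [simp]: "f \<in> hom A B \<Longrightarrow> idn B \<odot> f = f"
  and seq_ident [simp]: "f \<in> hom A B \<Longrightarrow> f \<odot> idn A = f"
  using seq_unit by blast+

lemma seq_hom: "f \<in> hom A B \<Longrightarrow> g \<in> hom B C \<Longrightarrow> g \<odot> f \<in> hom A C"
proof -
  assume "f \<in> hom A B" "g \<in> hom B C"
  then obtain Fs Gs where "Fs \<in> tests T A B" "f \<in> set Fs" "Gs \<in> tests T B C" "g \<in> set Gs"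
    using hom_in_test by blast
  then show "g \<odot> f \<in> hom A C"
    using tests_hom[OF tests_seq, of Fs A B Gs C] by fastforce
qed

lemma par_hom: "f \<in> hom A B \<Longrightarrow> g \<in> hom C D \<Longrightarrow> f \<otimes> g \<in> hom (A \<star> C) (B \<star> D)"
proof -
  assume "f \<in> hom A B" "g \<in> hom C D"
  then obtain Fs Gs where "Fs \<in> tests T A B" "f \<in> set Fs" "Gs \<in> tests T C D" "g \<in> set Gs"
    using hom_in_test by blast
  then show "f \<otimes> g \<in> hom (A \<star> C) (B \<star> D)"
    using tests_hom[OF tests_par, of Fs A B Gs C D] by fastforce
qed

lemma par_state: "\<rho> \<in> hom I A \<Longrightarrow> \<sigma> \<in> hom I B \<Longrightarrow> \<rho> \<otimes> \<sigma> \<in> hom I (A \<star> B)"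
  and par_effect: "a \<in> hom A I \<Longrightarrow> b \<in> hom B I \<Longrightarrow> a \<otimes> b \<in> hom (A \<star> B) I"
  using par_hom[of \<rho> I A \<sigma> I B] par_hom[of a A I b B I] by simp_all

lemma seq_add_right: "x \<in> span (hom A B) \<Longrightarrow> y \<in> span (hom A B) \<Longrightarrow> z \<in> span (hom B C) \<Longrightarrow>
    z \<odot> (x + y) = z \<odot> x + z \<odot> y"
  and seq_scale_right: "x \<in> span (hom A B) \<Longrightarrow> z \<in> span (hom B C) \<Longrightarrow> z \<odot> (c *\<^sub>R x) = c *\<^sub>R (z \<odot> x)"
  and seq_add_left: "x' \<in> span (hom B C) \<Longrightarrow> y' \<in> span (hom B C) \<Longrightarrow> z' \<in> span (hom A B) \<Longrightarrow>
    (x' + y') \<odot> z' = x' \<odot> z' + y' \<odot> z'"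
  and seq_scale_left: "x' \<in> span (hom B C) \<Longrightarrow> z' \<in> span (hom A B) \<Longrightarrow> (c *\<^sub>R x') \<odot> z' = c *\<^sub>R (x' \<odot> z')"
  using seq_linear_right seq_linear_left by blast+

lemma par_add_right: "x \<in> span (hom A B) \<Longrightarrow> y \<in> span (hom A B) \<Longrightarrow> z \<in> span (hom C D) \<Longrightarrow>
    z \<otimes> (x + y) = z \<otimes> x + z \<otimes> y"
  and par_scale_right: "x \<in> span (hom A B) \<Longrightarrow> z \<in> span (hom C D) \<Longrightarrow> z \<otimes> (c *\<^sub>R x) = c *\<^sub>R (z \<otimes> x)"
  and par_add_left: "x \<in> span (hom A B) \<Longrightarrow> y \<in> span (hom A B) \<Longrightarrow> z \<in> span (hom C D) \<Longrightarrow>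
    (x + y) \<otimes> z = x \<otimes> z + y \<otimes> z"
  and par_scale_left: "x \<in> span (hom A B) \<Longrightarrow> z \<in> span (hom C D) \<Longrightarrow> (c *\<^sub>R x) \<otimes> z = c *\<^sub>R (x \<otimes> z)"
  using par_bilinear by blast+

lemma seq_zero_right: "z \<in> span (hom B C) \<Longrightarrow> z \<odot> 0 = 0"
  and seq_zero_left: "z' \<in> span (hom A B) \<Longrightarrow> 0 \<odot> z' = 0"
  using seq_scale_right[of 0 A B z C 0] seq_scale_left[of 0 B C z' A 0] by (simp_all add: span_zero)

lemma par_zero_right: "z \<in> span (hom C D) \<Longrightarrow> z \<otimes> 0 = 0"
  and par_zero_left: "z \<in> span (hom C D) \<Longrightarrow> 0 \<otimes> z = 0"
  using par_scale_right[of 0 A B z C D 0] par_scale_left[of 0 A B z C D 0] by (simp_all add: span_zero)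

lemma seq_span:
  assumes x: "x \<in> span (hom A B)" and y: "y \<in> span (hom B C)"
  shows "y \<odot> x \<in> span (hom A C)"
proof -
  have g: "g \<odot> x \<in> span (hom A C)" if g: "g \<in> hom B C" for g
  proof -
    have "span (hom A B) \<subseteq> {x \<in> span (hom A B). g \<odot> x \<in> span (hom A C)}"
    proof (rule span_minimal)
      show "hom A B \<subseteq> {x \<in> span (hom A B). g \<odot> x \<in> span (hom A C)}"
        using g by (auto simp: hom_span seq_hom)
      show "subspace {x \<in> span (hom A B). g \<odot> x \<in> span (hom A C)}"
        using hom_span[OF g] by (intro subspaceI)
          (auto simp: seq_zero_right seq_add_right[of _ A B _ _ C] seq_scale_right[of _ A B _ C]
            span_zero span_add span_scale)
    qed
    then show ?thesis using x by blast
  qed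
  have "span (hom B C) \<subseteq> {y \<in> span (hom B C). y \<odot> x \<in> span (hom A C)}"
  proof (rule span_minimal)
    show "hom B C \<subseteq> {y \<in> span (hom B C). y \<odot> x \<in> span (hom A C)}"
      using g by (auto simp: hom_span)
    show "subspace {y \<in> span (hom B C). y \<odot> x \<in> span (hom A C)}"
      using x by (intro subspaceI)
        (auto simp: seq_zero_left seq_add_left[of _ B C _ _ A] seq_scale_left[of _ B C _ A]
          span_zero span_add span_scale)
  qed
  then show ?thesis using y by blast
qed

lemma par_span:
  assumes x: "x \<in> span (hom A B)" and y: "y \<in> span (hom C D)"
  shows "x \<otimes> y \<in> span (hom (A \<star> C) (B \<star> D))"
proof -
  have g: "x \<otimes> g \<in> span (hom (A \<star> C) (B \<star> D))" if g: "g \<in> hom C D" for g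
  proof -
    have "span (hom A B) \<subseteq> {x \<in> span (hom A B). x \<otimes> g \<in> span (hom (A \<star> C) (B \<star> D))}"
    proof (rule span_minimal)
      show "hom A B \<subseteq> {x \<in> span (hom A B). x \<otimes> g \<in> span (hom (A \<star> C) (B \<star> D))}"
        using g by (auto simp: hom_span par_hom)
      show "subspace {x \<in> span (hom A B). x \<otimes> g \<in> span (hom (A \<star> C) (B \<star> D))}"
        using hom_span[OF g] by (intro subspaceI)
          (auto simp: par_zero_left par_add_left[of _ A B _ _ C D] par_scale_left[of _ A B _ C D]
            span_zero span_add span_scale)
    qed
    then show ?thesis using x by blast
  qed
  have "span (hom C D) \<subseteq> {y \<in> span (hom C D). x \<otimes> y \<in> span (hom (A \<star> C) (B \<star> D))}"
  proof (rule span_minimal)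
    show "hom C D \<subseteq> {y \<in> span (hom C D). x \<otimes> y \<in> span (hom (A \<star> C) (B \<star> D))}"
      using g by (auto simp: hom_span)
    show "subspace {y \<in> span (hom C D). x \<otimes> y \<in> span (hom (A \<star> C) (B \<star> D))}"
      using x by (intro subspaceI)
        (auto simp: par_zero_right par_add_right[of _ C D _ _ A B] par_scale_right[of _ C D _ A B]
          span_zero span_add span_scale)
  qed
  then show ?thesis using y by blast
qed

lemma scal_scaleR [simp]: "scal T (p *\<^sub>R idn I) = p"
  unfolding scal_def by (rule the_equality) auto

lemma scal_ident [simp]: "scal T (idn I) = 1"
  using scal_scaleR[of 1] by simp

lemma span_trivE:
  assumes "z \<in> span (hom I I)"
  obtains p where "z = p *\<^sub>R idn I"
proof -
  have "span (hom I I) \<subseteq> range (\<lambda>p. p *\<^sub>R idn I)"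
  proof (rule span_minimal)
    show "hom I I \<subseteq> range (\<lambda>p. p *\<^sub>R idn I)" by (auto simp: hom_triv)
    show "subspace (range (\<lambda>p. p *\<^sub>R idn I))"
    proof (rule subspaceI)
      show "0 \<in> range (\<lambda>p. p *\<^sub>R idn I)" by (rule range_eqI[of _ _ 0]) simp
      show "x + y \<in> range (\<lambda>p. p *\<^sub>R idn I)"
        if "x \<in> range (\<lambda>p. p *\<^sub>R idn I)" "y \<in> range (\<lambda>p. p *\<^sub>R idn I)" for x y
        using that by (clarsimp simp: scaleR_add_left[symmetric])
      show "c *\<^sub>R x \<in> range (\<lambda>p. p *\<^sub>R idn I)" if "x \<in> range (\<lambda>p. p *\<^sub>R idn I)" for c x
        using that by clarsimp
    qed
  qed
  then show thesis using assms that by blast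
qed

lemma span_triv: "z \<in> span (hom I I) \<Longrightarrow> z = scal T z *\<^sub>R idn I"
  by (erule span_trivE) simp

lemma scal_add: "x \<in> span (hom I I) \<Longrightarrow> y \<in> span (hom I I) \<Longrightarrow> scal T (x + y) = scal T x + scal T y"
  by (elim span_trivE) (simp flip: scaleR_add_left)

lemma scal_scale: "x \<in> span (hom I I) \<Longrightarrow> scal T (c *\<^sub>R x) = c * scal T x"
  by (elim span_trivE) simp

lemma ev_scalar: "a \<in> span (hom A I) \<Longrightarrow> \<rho> \<in> span (hom I A) \<Longrightarrow> a \<odot> \<rho> = ev a \<rho> *\<^sub>R idn I"
  unfolding pr_def by (rule span_triv) (rule seq_span)

lemma ev_bounds:
  assumes "a \<in> hom A I" "\<rho> \<in> hom I A"
  shows "0 \<le> ev a \<rho>" "ev a \<rho> \<le> 1"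
  using seq_hom[OF assms(2,1)] unfolding pr_def by (auto simp: hom_triv)

lemma ev_add_right: "a \<in> span (hom A I) \<Longrightarrow> x \<in> span (hom I A) \<Longrightarrow> y \<in> span (hom I A) \<Longrightarrow>
    ev a (x + y) = ev a x + ev a y"
  unfolding pr_def by (simp add: seq_add_right[of _ I A _ _ I] scal_add seq_span)

lemma ev_scale_right: "a \<in> span (hom A I) \<Longrightarrow> x \<in> span (hom I A) \<Longrightarrow> ev a (c *\<^sub>R x) = c * ev a x"
  unfolding pr_def by (simp add: seq_scale_right[of _ I A _ I] scal_scale seq_span)

lemma ev_add_left: "x \<in> span (hom A I) \<Longrightarrow> y \<in> span (hom A I) \<Longrightarrow> \<rho> \<in> span (hom I A) \<Longrightarrow>
    ev (x + y) \<rho> = ev x \<rho> + ev y \<rho>"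
  unfolding pr_def by (simp add: seq_add_left[of _ A I _ _ I] scal_add seq_span)

lemma ev_zero_right: "a \<in> hom A I \<Longrightarrow> ev a 0 = 0"
  using ev_scale_right[of a A 0 0] by (simp add: hom_span span_zero)

lemma ev_seq: "f \<in> hom A B \<Longrightarrow> \<rho> \<in> hom I A \<Longrightarrow> e \<in> hom B I \<Longrightarrow> ev e (f \<odot> \<rho>) = ev (e \<odot> f) \<rho>"
  unfolding pr_def by (simp add: seq_assoc)

lemma hom_mix:
  assumes "f \<in> hom A B" "g \<in> hom A B" "0 \<le> p" "p \<le> 1"
  shows "(1 - p) *\<^sub>R f + p *\<^sub>R g \<in> hom A B"
  using hom_convex_compact[of A B] assms by (auto intro: convexD)

lemma scale_state:
  assumes "f \<in> hom I A" "0 \<le> p" "p \<le> 1"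
  shows "p *\<^sub>R f \<in> hom I A" "p *\<^sub>R f = f \<odot> (p *\<^sub>R idn I)"
proof -
  show "p *\<^sub>R f = f \<odot> (p *\<^sub>R idn I)"
    using assms by (simp add: seq_scale_right[of _ I I _ A] hom_span)
  moreover have "p *\<^sub>R idn I \<in> hom I I" using assms by (auto simp: hom_triv)
  ultimately show "p *\<^sub>R f \<in> hom I A" using seq_hom assms by metis
qed

lemma det_eff_channel: "u A \<in> channels T A I"
  and det_eff_unique: "c \<in> channels T A I \<Longrightarrow> c = u A"
  and sum_test: "es \<in> tests T A I \<Longrightarrow> sum_list es = u A"
proof -
  have ex: "\<exists>!v. v \<in> channels T A I" using causal unfolding causal_def by blast
  then show "u A \<in> channels T A I" unfolding det_eff_def by (rule theI')
  with ex show "c \<in> channels T A I \<Longrightarrow> c = u A" by blast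
  show "es \<in> tests T A I \<Longrightarrow> sum_list es = u A" using causal unfolding causal_def by blast
qed

lemma u_hom [simp]: "u A \<in> hom A I"
  using det_eff_channel by (rule channel_hom)

lemma u_triv [simp]: "u I = idn I"
  using det_eff_unique ident_channel by metis

lemma channel_seq: "C \<in> channels T A B \<Longrightarrow> D \<in> channels T B E \<Longrightarrow> D \<odot> C \<in> channels T A E"
  using tests_seq[of "[C]" A B "[D]" E] by (simp add: channels_def)

lemma channel_par: "C \<in> channels T A B \<Longrightarrow> D \<in> channels T A' B' \<Longrightarrow> C \<otimes> D \<in> channels T (A \<star> A') (B \<star> B')"
  using tests_par[of "[C]" A B "[D]" A' B'] by (simp add: channels_def)

lemma u_channel: "C \<in> channels T A B \<Longrightarrow> u B \<odot> C = u A"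
  by (rule det_eff_unique) (rule channel_seq[OF _ det_eff_channel])

lemma u_tensor: "u (A \<star> B) = u A \<otimes> u B"
  using det_eff_unique[of "u A \<otimes> u B" "A \<star> B"]
    channel_par[OF det_eff_channel[of A] det_eff_channel[of B]] by simp

lemma nst_iff: "\<rho> \<in> nst A \<longleftrightarrow> \<rho> \<in> hom I A \<and> ev (u A) \<rho> = 1"
  by (auto simp: normalized_states_def)

lemma nst_hom: "\<rho> \<in> nst A \<Longrightarrow> \<rho> \<in> hom I A" and nst_u: "\<rho> \<in> nst A \<Longrightarrow> ev (u A) \<rho> = 1"
  by (auto simp: nst_iff)

lemma nst_nonzero: "\<rho> \<in> nst A \<Longrightarrow> \<rho> \<noteq> 0"
  using ev_zero_right[of "u A" A] by (auto simp: nst_iff)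

lemma channel_nst: "C \<in> channels T I A \<Longrightarrow> C \<in> nst A"
  using channel_hom u_channel[of C I A] by (auto simp: nst_iff pr_def)

lemma channel_apply_nst:
  assumes "C \<in> channels T A B" "\<rho> \<in> nst A" shows "C \<odot> \<rho> \<in> nst B"
  using assms by (simp add: nst_iff seq_hom[of _ I A _ B] channel_hom ev_seq[of C A B] u_channel)

text \<open>Applied to \<open>\<phi>\<close> that are nonnegative on effects, this replaces the (not necessarily
  available) effect \<open>u - a\<close>, which a test provides only as a sum of outcomes.\<close>
lemma functional_le_det_eff:
  fixes \<phi> :: "'t \<Rightarrow> real"
  assumes add: "\<And>x y. x \<in> span (hom A I) \<Longrightarrow> y \<in> span (hom A I) \<Longrightarrow> \<phi> (x + y) = \<phi> x + \<phi> y"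
    and nonneg: "\<And>e. e \<in> hom A I \<Longrightarrow> 0 \<le> \<phi> e"
    and a: "a \<in> hom A I"
  shows "\<phi> a \<le> \<phi> (u A)"
proof -
  obtain es where es: "es \<in> tests T A I" "a \<in> set es" using hom_in_test[OF a] by blast
  then obtain e1 e2 where sp: "es = e1 @ a # e2" by (meson split_list)
  have h: "set es \<subseteq> hom A I" using tests_hom es by blast
  have zero: "\<phi> 0 = 0" using add[of 0 0] by (simp add: span_zero)
  have "sum_list xs \<in> span (hom A I) \<and> 0 \<le> \<phi> (sum_list xs)" if "set xs \<subseteq> hom A I" for xs
    using that by (induction xs) (auto simp: zero span_zero hom_span span_add add nonneg)
  note L = this
  have "sum_list e1 \<in> span (hom A I)" "0 \<le> \<phi> (sum_list e1)"
    "sum_list e2 \<in> span (hom A I)" "0 \<le> \<phi> (sum_list e2)"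
    using L[of e1] L[of e2] h sp by auto
  moreover have "u A = sum_list e1 + (a + sum_list e2)" using sum_test[OF es(1)] sp by simp
  ultimately show ?thesis using a by (simp add: add hom_span span_add)
qed

lemma ev_le_u: "a \<in> hom A I \<Longrightarrow> \<rho> \<in> hom I A \<Longrightarrow> ev a \<rho> \<le> ev (u A) \<rho>"
  by (rule functional_le_det_eff[where \<phi> = "\<lambda>a. ev a \<rho>"]) (auto simp: ev_add_left hom_span ev_bounds)

lemma par_unit [simp]: "f \<in> hom A B \<Longrightarrow> idn I \<otimes> f = f" "f \<in> hom A B \<Longrightarrow> f \<otimes> idn I = f"
  using par_scalar[of "idn I" f A B] by simp_all

lemma seq_sum_left:
  assumes "\<And>j. j \<in> J \<Longrightarrow> f j \<in> hom B C" "z \<in> span (hom A B)" "finite J"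
  shows "(\<Sum>j\<in>J. f j) \<odot> z = (\<Sum>j\<in>J. f j \<odot> z)"
  using assms(3,1)
proof (induction J)
  case empty
  then show ?case using seq_zero_left[OF assms(2)] by simp
next
  case (insert j J)
  then show ?case using assms(2)
    by (simp add: seq_add_left[of _ B C _ _ A] hom_span span_sum)
qed

lemma par_sum_left:
  assumes "\<And>j. j \<in> J \<Longrightarrow> f j \<in> hom A B" "z \<in> span (hom C D)" "finite J"
  shows "(\<Sum>j\<in>J. f j) \<otimes> z = (\<Sum>j\<in>J. f j \<otimes> z)"
  using assms(3,1)
proof (induction J)
  case empty
  then show ?case using par_zero_left[OF assms(2)] by simp
next
  case (insert j J)
  then show ?case using assms(2)
    by (simp add: par_add_left[of _ A B _ _ C D] hom_span span_sum)
qed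

lemma par_sum_right:
  assumes "\<And>j. j \<in> J \<Longrightarrow> f j \<in> hom A B" "z \<in> span (hom C D)" "finite J"
  shows "z \<otimes> (\<Sum>j\<in>J. f j) = (\<Sum>j\<in>J. z \<otimes> f j)"
  using assms(3,1)
proof (induction J)
  case empty
  then show ?case using par_zero_right[OF assms(2)] by simp
next
  case (insert j J)
  then show ?case using assms(2)
    by (simp add: par_add_right[of _ A B _ _ C D] hom_span span_sum)
qed

lemma par_factor:
  assumes "f \<in> hom A B" "g \<in> hom C D"
  shows "(f \<otimes> idn D) \<odot> (idn A \<otimes> g) = f \<otimes> g" "(idn B \<otimes> g) \<odot> (f \<otimes> idn C) = f \<otimes> g"
  using interchange[of "idn A" A A f B g C D "idn D" D] interchange[of f A B "idn B" B "idn C" C C g D] assms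
  by simp_all

lemma ev_par:
  assumes "a \<in> hom A I" "b \<in> hom B I" "\<rho> \<in> hom I A" "\<sigma> \<in> hom I B"
  shows "ev (a \<otimes> b) (\<rho> \<otimes> \<sigma>) = ev a \<rho> * ev b \<sigma>"
proof -
  have "(a \<otimes> b) \<odot> (\<rho> \<otimes> \<sigma>) = (a \<odot> \<rho>) \<otimes> (b \<odot> \<sigma>)"
    using interchange[of \<rho> I A a I \<sigma> I B b I] assms by simp
  also have "\<dots> = ev a \<rho> *\<^sub>R (b \<odot> \<sigma>)"
    using par_scalar[OF seq_hom[OF assms(3,1)] seq_hom[OF assms(4,2)]] by (simp add: pr_def)
  also have "\<dots> = (ev a \<rho> * ev b \<sigma>) *\<^sub>R idn I"
    using ev_scalar[of b B \<sigma>] assms by (simp add: hom_span)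
  finally show ?thesis unfolding pr_def[of T "a \<otimes> b"] by simp
qed

lemma apply_right_hom: "\<Psi> \<in> hom I (A \<star> B) \<Longrightarrow> g \<in> hom B C \<Longrightarrow> (idn A \<otimes> g) \<odot> \<Psi> \<in> hom I (A \<star> C)"
  using seq_hom[OF _ par_hom[OF ident_hom[of A]]] by metis

lemma apply_left_hom: "\<Psi> \<in> hom I (A \<star> B) \<Longrightarrow> g \<in> hom A C \<Longrightarrow> (g \<otimes> idn B) \<odot> \<Psi> \<in> hom I (C \<star> B)"
  using seq_hom[OF _ par_hom[OF _ ident_hom[of B]]] by metis

lemma ev_apply_right:
  assumes "\<Psi> \<in> hom I (A \<star> B)" "g \<in> hom B C" "h \<in> hom A I" "f \<in> hom C I"
  shows "ev (h \<otimes> f) ((idn A \<otimes> g) \<odot> \<Psi>) = ev (h \<otimes> (f \<odot> g)) \<Psi>"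
  using ev_seq[OF par_hom[OF ident_hom[of A] assms(2)] assms(1) par_effect[OF assms(3,4)]]
    interchange[of "idn A" A A h I g B C f I] assms by simp

lemma contract_right_hom: "\<Psi> \<in> hom I (A \<star> B) \<Longrightarrow> b \<in> hom B I \<Longrightarrow> (idn A \<otimes> b) \<odot> \<Psi> \<in> hom I A"
  using apply_right_hom[of \<Psi> A B b I] by simp

lemma contract_left_hom: "\<Psi> \<in> hom I (A \<star> B) \<Longrightarrow> a \<in> hom A I \<Longrightarrow> (a \<otimes> idn B) \<odot> \<Psi> \<in> hom I B"
  using apply_left_hom[of \<Psi> A B a I] by simp

lemma ev_contract_right:
  assumes "\<Psi> \<in> hom I (A \<star> B)" "b \<in> hom B I" "h \<in> hom A I"
  shows "ev h ((idn A \<otimes> b) \<odot> \<Psi>) = ev (h \<otimes> b) \<Psi>"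
  using ev_apply_right[of \<Psi> A B b I h "idn I"] assms by simp

lemma ev_contract_left:
  assumes "\<Psi> \<in> hom I (A \<star> B)" "a \<in> hom A I" "h \<in> hom B I"
  shows "ev h ((a \<otimes> idn B) \<odot> \<Psi>) = ev (a \<otimes> h) \<Psi>"
  using ev_seq[of "a \<otimes> idn B" "A \<star> B" B \<Psi> h] par_hom[of a A I "idn B" B B] par_factor(2)[of a A I h B I] assms
  by simp

lemma state_eqI:
  assumes x: "x \<in> span (hom I A)" and y: "y \<in> span (hom I A)"
    and eq: "\<And>b. b \<in> hom A I \<Longrightarrow> ev b x = ev b y"
  shows "x = y"
proof -
  have *: "ev b ((z \<otimes> idn E) \<odot> \<rho>) = ev (b \<odot> (idn A \<otimes> \<rho>)) z"
    if z: "z \<in> span (hom I A)" and \<rho>: "\<rho> \<in> hom I E" and b: "b \<in> hom (A \<star> E) I" for z E \<rho> b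
  proof -
    let ?P = "{z \<in> span (hom I A). ev b ((z \<otimes> idn E) \<odot> \<rho>) = ev (b \<odot> (idn A \<otimes> \<rho>)) z}"
    have ir: "idn A \<otimes> \<rho> \<in> hom A (A \<star> E)" using par_hom[OF ident_hom[of A] \<rho>] by simp
    have br: "b \<odot> (idn A \<otimes> \<rho>) \<in> hom A I" using ir b by (rule seq_hom)
    have zi: "w \<otimes> idn E \<in> span (hom E (A \<star> E))" if "w \<in> span (hom I A)" for w
      using par_span[OF that hom_span[OF ident_hom[of E]]] by simp
    have zr: "(w \<otimes> idn E) \<odot> \<rho> \<in> span (hom I (A \<star> E))" if "w \<in> span (hom I A)" for w
      using hom_span[OF \<rho>] zi[OF that] by (rule seq_span)
    have "span (hom I A) \<subseteq> ?P"
    proof (rule span_minimal)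
      show "hom I A \<subseteq> ?P"
      proof
        fix z assume z: "z \<in> hom I A"
        have "(z \<otimes> idn E) \<odot> \<rho> = z \<otimes> \<rho>" using par_factor(1)[OF z \<rho>] \<rho> by simp
        moreover have "(idn A \<otimes> \<rho>) \<odot> z = z \<otimes> \<rho>" using par_factor(2)[OF z \<rho>] z by simp
        ultimately show "z \<in> ?P" using ev_seq[OF ir z b] z by (simp add: hom_span)
      qed
      show "subspace ?P"
      proof (rule subspaceI)
        have [simp]: "ev e 0 = 0" if "e \<in> hom B I" for e B
          using ev_zero_right that .
        show "0 \<in> ?P"
          using b br \<rho> by (simp add: span_zero par_zero_left[OF hom_span[OF ident_hom]] seq_zero_left[OF hom_span[OF \<rho>]])
        show "v + w \<in> ?P" if "v \<in> ?P" "w \<in> ?P" for v w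
          using that b br \<rho> zi zr
          by (simp add: span_add par_add_left[of _ I A _ _ E E] hom_span seq_add_left[of _ E "A \<star> E" _ _ I]
              ev_add_right[of _ A] ev_add_right[of _ "A \<star> E"])
        show "c *\<^sub>R v \<in> ?P" if "v \<in> ?P" for c v
          using that b br \<rho> zi zr
          by (simp add: span_scale par_scale_left[of _ I A _ E E] hom_span seq_scale_left[of _ E "A \<star> E" _ I]
              ev_scale_right[of _ A] ev_scale_right[of _ "A \<star> E"])
      qed
    qed
    with z show ?thesis by blast
  qed
  have "ev b ((x \<otimes> idn E) \<odot> \<rho>) = ev b ((y \<otimes> idn E) \<odot> \<rho>)"
    if "\<rho> \<in> hom I E" "b \<in> hom (A \<star> E) I" for E \<rho> b
  proof -
    have "b \<odot> (idn A \<otimes> \<rho>) \<in> hom A I"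
      using par_hom[OF ident_hom[of A] that(1)] that(2) by (simp add: seq_hom[of _ A "A \<star> E" _ I])
    then show ?thesis using *[OF x that] *[OF y that] eq by simp
  qed
  then show ?thesis using op_equiv x y by (metis (no_types, lifting) effects_eq states_eq sys_simps(2))
qed

lemma state_realization:
  assumes "\<rho> \<in> hom I A"
  obtains E C e where "C \<in> nst (A \<star> E)" "e \<in> hom E I" "\<rho> = (idn A \<otimes> e) \<odot> C"
proof -
  obtain Ts where Ts: "Ts \<in> tests T I A" "\<rho> \<in> set Ts" using hom_in_test[OF assms] by blast
  then obtain i where i: "i < length Ts" "\<rho> = Ts ! i" by (metis in_set_conv_nth)
  obtain E C es where *: "C \<in> channels T I (A \<star> E)" "es \<in> tests T E I" "length es = length Ts"
    "\<forall>i < length Ts. Ts ! i = (idn A \<otimes> (es ! i)) \<odot> C"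
    using realization[OF Ts(1)] by blast
  show thesis
  proof (rule that)
    show "C \<in> nst (A \<star> E)" using *(1) by (rule channel_nst)
    show "es ! i \<in> hom E I" using tests_hom[OF *(2)] *(3) i(1) by (metis nth_mem subsetD)
    show "\<rho> = (idn A \<otimes> es ! i) \<odot> C" using * i by simp
  qed
qed

lemma effect_eqI:
  assumes a: "a \<in> hom A I" "a' \<in> hom A I"
    and eq: "\<And>R \<Gamma> r. \<Gamma> \<in> nst (A \<star> R) \<Longrightarrow> r \<in> hom R I \<Longrightarrow> ev (a \<otimes> r) \<Gamma> = ev (a' \<otimes> r) \<Gamma>"
  shows "a = a'"
proof -
  have "ev b ((a \<otimes> idn E) \<odot> \<rho>) = ev b ((a' \<otimes> idn E) \<odot> \<rho>)"
    if \<rho>: "\<rho> \<in> hom I (A \<star> E)" and b: "b \<in> hom E I" for E \<rho> b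
  proof -
    obtain F C e where C: "C \<in> nst ((A \<star> E) \<star> F)" "e \<in> hom F I" "\<rho> = (idn (A \<star> E) \<otimes> e) \<odot> C"
      using state_realization[OF \<rho>] by blast
    have "ev b ((c \<otimes> idn E) \<odot> \<rho>) = ev (c \<otimes> (b \<otimes> e)) C" if c: "c \<in> hom A I" for c
    proof -
      have "ev b ((c \<otimes> idn E) \<odot> \<rho>) = ev (c \<otimes> b) \<rho>" using \<rho> b c by (simp add: ev_contract_left)
      also have "\<dots> = ev ((c \<otimes> b) \<otimes> e) C"
        using ev_contract_right[OF nst_hom[OF C(1)] C(2) par_effect[OF c b]] C(3) by simp
      also have "(c \<otimes> b) \<otimes> e = c \<otimes> (b \<otimes> e)" using par_assoc[OF c b C(2)] .
      finally show ?thesis .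
    qed
    then show ?thesis using eq[OF C(1)[simplified] par_effect[OF b C(2)]] a by simp
  qed
  then show ?thesis using op_equiv a
    by (metis (no_types, lifting) effects_eq states_eq sys_simps(2) hom_span)
qed

lemma nst_par: "\<rho> \<in> nst A \<Longrightarrow> \<sigma> \<in> nst B \<Longrightarrow> \<rho> \<otimes> \<sigma> \<in> nst (A \<star> B)"
  by (simp add: nst_iff par_state u_tensor ev_par[of _ A _ B])

lemma nst_exists: "\<exists>\<rho>. \<rho> \<in> nst A"
proof -
  obtain a \<rho> where "pure T A I a" "\<rho> \<in> hom I A" "ev a \<rho> = 1"
    using sharpness unfolding pure_sharpness_def by (metis states_eq)
  then have "a \<in> hom A I" by (simp add: pure_def)
  then have "ev (u A) \<rho> = 1"
    using ev_le_u[of a A \<rho>] ev_bounds(2)[of "u A" A \<rho>] \<open>\<rho> \<in> hom I A\<close> \<open>ev a \<rho> = 1\<close> by simp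
  then show ?thesis using \<open>\<rho> \<in> hom I A\<close> by (auto simp: nst_iff)
qed

lemma sharp_nst: "a \<in> hom A I \<Longrightarrow> \<rho> \<in> hom I A \<Longrightarrow> ev a \<rho> = 1 \<Longrightarrow> \<rho> \<in> nst A"
  using ev_le_u[of a A \<rho>] ev_bounds(2)[of "u A" A \<rho>] by (simp add: nst_iff)

lemma nst_half: "\<rho> \<in> nst A \<Longrightarrow> \<sigma> \<in> nst A \<Longrightarrow> (1/2) *\<^sub>R \<rho> + (1/2) *\<^sub>R \<sigma> \<in> nst A"
  using hom_mix[of \<rho> I A \<sigma> "1/2"]
  by (simp add: nst_iff ev_add_right[of _ A] ev_scale_right[of _ A] hom_span span_scale)

lemma hom_half: "\<rho> \<in> hom A B \<Longrightarrow> \<sigma> \<in> hom A B \<Longrightarrow> (1/2) *\<^sub>R \<rho> + (1/2) *\<^sub>R \<sigma> \<in> hom A B"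
  using hom_mix[of \<rho> A B \<sigma> "1/2"] by simp

lemma ev_half: "a \<in> hom A I \<Longrightarrow> \<rho> \<in> hom I A \<Longrightarrow> \<sigma> \<in> hom I A \<Longrightarrow>
    ev a ((1/2) *\<^sub>R \<rho> + (1/2) *\<^sub>R \<sigma>) = (ev a \<rho> + ev a \<sigma>) / 2"
  by (simp add: ev_add_right[of _ A] ev_scale_right[of _ A] hom_span span_scale)

lemma pure_hom: "pure T A B f \<Longrightarrow> f \<in> hom A B"
  by (simp add: pure_def)

lemma test_nth_hom: "Ds \<in> tests T A B \<Longrightarrow> J \<subseteq> {..<length Ds} \<Longrightarrow> i \<in> J \<Longrightarrow> Ds ! i \<in> hom A B"
  using tests_hom[of Ds A B] by (auto intro: nth_mem)

lemma pure_seq: "pure T A B f \<Longrightarrow> pure T B C g \<Longrightarrow> pure T A C (g \<odot> f)"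
  and pure_par: "pure T A B f \<Longrightarrow> pure T C D k \<Longrightarrow> pure T (A \<star> C) (B \<star> D) (f \<otimes> k)"
  using purity unfolding purity_preservation_def by blast+

lemma pure_refinement:
  assumes pure: "pure T A C (\<Sum>j\<in>J. (Gs ! j) \<odot> f)" and f: "f \<in> hom A B" and Gs: "Gs \<in> tests T B C"
    and J: "J \<subseteq> {..<length Gs}" "j \<in> J"
  shows "\<exists>c\<ge>0. (Gs ! j) \<odot> f = c *\<^sub>R (\<Sum>j\<in>J. (Gs ! j) \<odot> f)"
proof -
  obtain Fs where Fs: "Fs \<in> tests T A B" "f \<in> set Fs" using hom_in_test[OF f] by blast
  then obtain F1 F2 where sp: "Fs = F1 @ f # F2" by (meson split_list)
  let ?L = "[g \<odot> f. f \<leftarrow> Fs, g \<leftarrow> Gs]"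
  define P where "P = [g \<odot> f. f \<leftarrow> F1, g \<leftarrow> Gs]"
  define Q where "Q = [g \<odot> f. f \<leftarrow> F2, g \<leftarrow> Gs]"
  have L: "?L = P @ map (\<lambda>g. g \<odot> f) Gs @ Q" by (simp add: sp P_def Q_def)
  have nth: "?L ! (length P + i) = (Gs ! i) \<odot> f" if "i < length Gs" for i
    unfolding L using that by (simp add: nth_append)
  let ?J = "(+) (length P) ` J"
  have sub: "?J \<subseteq> {..<length ?L}" using J(1) unfolding L by auto
  have "(\<Sum>j\<in>?J. ?L ! j) = (\<Sum>j\<in>J. (Gs ! j) \<odot> f)"
    using J(1) nth by (subst sum.reindex) (auto intro!: sum.cong)
  then have "\<forall>i\<in>?J. \<exists>c\<ge>0. ?L ! i = c *\<^sub>R (\<Sum>j\<in>J. (Gs ! j) \<odot> f)"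
    using pure tests_seq[OF Fs(1) Gs] sub unfolding pure_def by metis
  moreover have "?L ! (length P + j) = (Gs ! j) \<odot> f" using nth J by blast
  ultimately show ?thesis using J(2) by fastforce
qed

text \<open>A state with a pure marginal is a product state, as far as effects on the second factor can tell.\<close>
lemma pure_marginal_contract:
  assumes \<Psi>: "\<Psi> \<in> hom I (A \<star> B)" and pure: "pure T I A ((idn A \<otimes> u B) \<odot> \<Psi>)" and e: "e \<in> hom B I"
  shows "\<exists>c\<ge>0. (idn A \<otimes> e) \<odot> \<Psi> = c *\<^sub>R ((idn A \<otimes> u B) \<odot> \<Psi>)"
proof -
  obtain es where es: "es \<in> tests T B I" "e \<in> set es" using hom_in_test[OF e] by blast
  have h: "es ! j \<in> hom B I" if "j < length es" for j using tests_hom[OF es(1)] that by auto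
  let ?Gs = "map (\<lambda>e. idn A \<otimes> e) es"
  have Gs: "?Gs \<in> tests T (A \<star> B) A"
    using tests_par[OF channel_test[OF ident_channel[of A]] es(1)] by simp
  have eq: "(\<Sum>j\<in>{..<length ?Gs}. (?Gs ! j) \<odot> \<Psi>) = (idn A \<otimes> u B) \<odot> \<Psi>"
  proof -
    have "u B = (\<Sum>j<length es. es ! j)"
      using sum_test[OF es(1)] by (simp add: sum_list_sum_nth atLeast0LessThan)
    then have "idn A \<otimes> u B = (\<Sum>j<length es. idn A \<otimes> es ! j)"
      using par_sum_right[of "{..<length es}" "\<lambda>j. es ! j" B I "idn A" A A] h by (simp add: hom_span)
    moreover have "idn A \<otimes> es ! j \<in> hom (A \<star> B) A" if "j < length es" for j
      using par_hom[OF ident_hom[of A] h[OF that]] by simp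
    ultimately show ?thesis
      using seq_sum_left[of "{..<length es}" "\<lambda>j. idn A \<otimes> es ! j" "A \<star> B" A \<Psi> I] \<Psi> by (simp add: hom_span)
  qed
  obtain j where j: "j < length es" "es ! j = e" using es(2) by (metis in_set_conv_nth)
  show ?thesis
    using pure_refinement[OF _ \<Psi> Gs, of "{..<length ?Gs}" j] pure j unfolding eq by simp
qed

lemma pure_scale:
  assumes x: "pure T I A x" and p: "0 \<le> p" "p \<le> 1"
  shows "pure T I A (p *\<^sub>R x)"
proof -
  have "pure T I I (p *\<^sub>R idn I)"
    unfolding pure_def
  proof (intro conjI ballI allI impI)
    show "p *\<^sub>R idn I \<in> hom I I" using p by (auto simp: hom_triv)
    fix Ds J j assume Ds: "Ds \<in> tests T I I" and J: "J \<subseteq> {..<length Ds}"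
      and eq: "p *\<^sub>R idn I = (\<Sum>j\<in>J. Ds ! j)" and j: "j \<in> J"
    have "\<forall>i\<in>J. \<exists>q\<ge>0. Ds ! i = q *\<^sub>R idn I"
    proof
      fix i assume "i \<in> J"
      then have "Ds ! i \<in> hom I I" using test_nth_hom[OF Ds J] by blast
      then show "\<exists>q\<ge>0. Ds ! i = q *\<^sub>R idn I" by (auto simp: hom_triv)
    qed
    then obtain q where q: "\<And>i. i \<in> J \<Longrightarrow> 0 \<le> q i" "\<And>i. i \<in> J \<Longrightarrow> Ds ! i = q i *\<^sub>R idn I" by metis
    have "p *\<^sub>R idn I = sum q J *\<^sub>R idn I" using eq q(2) by (simp add: scaleR_sum_left)
    then have ps: "p = sum q J" by simp
    have fin: "finite J" using J finite_subset by blast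
    show "\<exists>c\<ge>0. Ds ! j = c *\<^sub>R (p *\<^sub>R idn I)"
    proof (cases "p = 0")
      case True
      then have "q j = 0" using ps sum_nonneg_eq_0_iff[OF fin, of q] q(1) j by auto
      then show ?thesis using q(2)[OF j] by (intro exI[of _ 0]) simp
    next
      case False
      then show ?thesis using q[OF j] p by (intro exI[of _ "q j / p"]) simp
    qed
  qed
  from pure_seq[OF this x] show ?thesis using scale_state(2)[OF pure_hom[OF x] p] by simp
qed

lemma pure_reversible_state:
  assumes U: "U \<in> channels T A B" and V: "V \<in> channels T B A"
    and VU: "V \<odot> U = idn A" and UV: "U \<odot> V = idn B" and x: "pure T I A x"
  shows "pure T I B (U \<odot> x)"
  unfolding pure_def
proof (intro conjI ballI allI impI)
  note h = pure_hom[OF x] channel_hom[OF U] channel_hom[OF V]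
  show "U \<odot> x \<in> hom I B" using h by (metis seq_hom)
  fix Ds J j assume Ds: "Ds \<in> tests T I B" and J: "J \<subseteq> {..<length Ds}"
    and eq: "U \<odot> x = (\<Sum>j\<in>J. Ds ! j)" and j: "j \<in> J"
  have D: "Ds ! i \<in> hom I B" if "i \<in> J" for i by (rule test_nth_hom[OF Ds J that])
  have fin: "finite J" using J finite_subset by blast
  have t: "map (\<lambda>f. V \<odot> f) Ds \<in> tests T I A"
    using tests_seq[OF Ds channel_test[OF V]] by simp
  have sum: "V \<odot> (\<Sum>j\<in>J. Ds ! j) = (\<Sum>j\<in>J. V \<odot> (Ds ! j))"
    using fin D
  proof (induction J)
    case empty
    then show ?case using seq_zero_right[OF hom_span[OF h(3)]] by simp
  next
    case (insert j J)
    then show ?case using h(3) by (simp add: seq_add_right[of _ I B _ _ A] hom_span span_sum)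
  qed
  have "x = V \<odot> (U \<odot> x)" using h VU seq_assoc[of x I A U B V A] by simp
  then have "x = (\<Sum>j\<in>J. map (\<lambda>f. V \<odot> f) Ds ! j)"
    using eq sum J by (metis (no_types, lifting) lessThan_iff nth_map subset_iff sum.cong)
  then obtain c where c: "c \<ge> 0" "map (\<lambda>f. V \<odot> f) Ds ! j = c *\<^sub>R x"
    using x t J j unfolding pure_def by (metis length_map)
  then have "V \<odot> (Ds ! j) = c *\<^sub>R x" using J j by auto
  then have "U \<odot> (V \<odot> (Ds ! j)) = c *\<^sub>R (U \<odot> x)"
    using h by (simp add: seq_scale_right[of _ I A _ B] hom_span)
  moreover have "U \<odot> (V \<odot> (Ds ! j)) = Ds ! j" using h UV seq_assoc[OF D[OF j] h(3) h(2)] D[OF j] by simp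
  ultimately show "\<exists>c\<ge>0. Ds ! j = c *\<^sub>R (U \<odot> x)" using c by auto
qed

lemma pure_reversible_effect:
  assumes U: "U \<in> channels T A B" and V: "V \<in> channels T B A"
    and VU: "V \<odot> U = idn A" and UV: "U \<odot> V = idn B" and b: "pure T B I b"
  shows "pure T A I (b \<odot> U)"
  unfolding pure_def
proof (intro conjI ballI allI impI)
  note h = pure_hom[OF b] channel_hom[OF U] channel_hom[OF V]
  show "b \<odot> U \<in> hom A I" using h by (metis seq_hom)
  fix Ds J j assume Ds: "Ds \<in> tests T A I" and J: "J \<subseteq> {..<length Ds}"
    and eq: "b \<odot> U = (\<Sum>j\<in>J. Ds ! j)" and j: "j \<in> J"
  have D: "Ds ! i \<in> hom A I" if "i \<in> J" for i by (rule test_nth_hom[OF Ds J that])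
  have fin: "finite J" using J finite_subset by blast
  have t: "map (\<lambda>f. f \<odot> V) Ds \<in> tests T B I"
    using tests_seq[OF channel_test[OF V] Ds] by simp
  have "b = (b \<odot> U) \<odot> V" using h UV seq_assoc[of V B A U B b I] by simp
  then have "b = (\<Sum>j\<in>J. (Ds ! j) \<odot> V)"
    using eq seq_sum_left[OF D hom_span[OF h(3)] fin] by simp
  also have "\<dots> = (\<Sum>j\<in>J. map (\<lambda>f. f \<odot> V) Ds ! j)"
    using J by (intro sum.cong) auto
  finally obtain c where c: "c \<ge> 0" "map (\<lambda>f. f \<odot> V) Ds ! j = c *\<^sub>R b"
    using b t J j unfolding pure_def by (metis length_map)
  then have "(Ds ! j) \<odot> V = c *\<^sub>R b" using J j by auto
  then have "((Ds ! j) \<odot> V) \<odot> U = c *\<^sub>R (b \<odot> U)"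
    using h by (simp add: seq_scale_left[of _ B I _ A] hom_span)
  moreover have "((Ds ! j) \<odot> V) \<odot> U = Ds ! j" using h VU seq_assoc[OF h(2) h(3) D[OF j]] D[OF j] by simp
  ultimately show "\<exists>c\<ge>0. Ds ! j = c *\<^sub>R (b \<odot> U)" using c by auto
qed

lemma purification_exists:
  assumes "\<rho> \<in> nst A"
  obtains B \<Psi> where "pure T I (A \<star> B) \<Psi>" "\<Psi> \<in> nst (A \<star> B)" "(idn A \<otimes> u B) \<odot> \<Psi> = \<rho>"
  using purif assms unfolding purification_def is_purification_def marginal_def by metis

lemma purification_unique:
  assumes "pure T I (A \<star> B) \<Psi>" "\<Psi> \<in> nst (A \<star> B)" "pure T I (A \<star> B) \<Psi>'" "\<Psi>' \<in> nst (A \<star> B)"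
    and eq: "(idn A \<otimes> u B) \<odot> \<Psi> = (idn A \<otimes> u B) \<odot> \<Psi>'"
  obtains U V where "U \<in> channels T B B" "V \<in> channels T B B" "V \<odot> U = idn B" "U \<odot> V = idn B"
    "\<Psi>' = (idn A \<otimes> U) \<odot> \<Psi>"
proof -
  let ?\<rho> = "(idn A \<otimes> u B) \<odot> \<Psi>"
  have "?\<rho> \<in> nst A"
    using channel_apply_nst[OF channel_par[OF ident_channel[of A] det_eff_channel[of B]] assms(2)] by simp
  moreover have "is_purification T A B ?\<rho> \<Psi>" "is_purification T A B ?\<rho> \<Psi>'"
    using assms by (auto simp: is_purification_def marginal_def)
  ultimately obtain U where "reversible T B B U" "\<Psi>' = (idn A \<otimes> U) \<odot> \<Psi>"
    using purif unfolding purification_def by meson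
  then show thesis using that unfolding reversible_def by blast
qed

subsection \<open>Pure effects determine states\<close>

lemma par_contract_commute:
  assumes D: "D \<in> hom A A" and e: "e \<in> hom F I" and \<Psi>: "\<Psi> \<in> hom I (A \<star> (E \<star> F))"
  shows "(D \<otimes> idn E) \<odot> ((idn (A \<star> E) \<otimes> e) \<odot> \<Psi>) = (idn (A \<star> E) \<otimes> e) \<odot> ((D \<otimes> idn (E \<star> F)) \<odot> \<Psi>)"
proof -
  let ?f = "D \<otimes> idn E"
  have f: "?f \<in> hom (A \<star> E) (A \<star> E)" using par_hom[OF D ident_hom] .
  have g: "idn (A \<star> E) \<otimes> e \<in> hom (A \<star> (E \<star> F)) (A \<star> E)"
    using par_hom[OF ident_hom[of "A \<star> E"] e] by simp
  have k: "?f \<otimes> idn F \<in> hom (A \<star> (E \<star> F)) (A \<star> (E \<star> F))" using par_hom[OF f ident_hom[of F]] by simp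
  have k_eq: "?f \<otimes> idn F = D \<otimes> idn (E \<star> F)"
    using par_assoc[OF D ident_hom[of E] ident_hom[of F]] by (simp only: ident_tensor[rule_format])
  have "?f \<odot> (idn (A \<star> E) \<otimes> e) = ?f \<otimes> e" using par_factor(1)[OF f e] f by simp
  also have "\<dots> = (idn (A \<star> E) \<otimes> e) \<odot> (?f \<otimes> idn F)" using par_factor(2)[OF f e] by simp
  finally have "?f \<odot> (idn (A \<star> E) \<otimes> e) = (idn (A \<star> E) \<otimes> e) \<odot> (?f \<otimes> idn F)" .
  then show ?thesis using seq_assoc[OF \<Psi> g f] seq_assoc[OF \<Psi> k g] k_eq by simp
qed

lemma eigenvalue_unique:
  assumes f: "f \<in> hom A A" and eig: "\<And>\<rho>. \<rho> \<in> nst A \<Longrightarrow> \<exists>c. f \<odot> \<rho> = c *\<^sub>R \<rho>"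
    and \<rho>: "\<rho> \<in> nst A" "f \<odot> \<rho> = c *\<^sub>R \<rho>" and \<sigma>: "\<sigma> \<in> nst A" "f \<odot> \<sigma> = d *\<^sub>R \<sigma>"
  shows "c = d"
proof -
  let ?m = "(1/2) *\<^sub>R \<rho> + (1/2) *\<^sub>R \<sigma>"
  obtain e where e: "f \<odot> ?m = e *\<^sub>R ?m" using eig nst_half[OF \<rho>(1) \<sigma>(1)] by blast
  note h = nst_hom[OF \<rho>(1)] nst_hom[OF \<sigma>(1)]
  have "f \<odot> ?m = (1/2) *\<^sub>R (c *\<^sub>R \<rho>) + (1/2) *\<^sub>R (d *\<^sub>R \<sigma>)"
    using f h \<rho>(2) \<sigma>(2)
    by (simp add: seq_add_right[of _ I A _ _ A] seq_scale_right[of _ I A _ A] hom_span span_scale)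
  then have "(1/2) *\<^sub>R ((c - e) *\<^sub>R \<rho>) = (1/2) *\<^sub>R ((e - d) *\<^sub>R \<sigma>)" using e by (simp add: algebra_simps)
  then have eq: "(c - e) *\<^sub>R \<rho> = (e - d) *\<^sub>R \<sigma>" unfolding scaleR_cancel_left by simp
  from arg_cong[OF eq, of "ev (u A)"] have ce: "c - e = e - d"
    using h nst_u[OF \<rho>(1)] nst_u[OF \<sigma>(1)] by (simp add: ev_scale_right[of _ A] hom_span)
  show ?thesis
  proof (cases "c = e")
    case True
    then show ?thesis using ce by simp
  next
    case False
    then have "\<rho> = \<sigma>" using eq ce by simp
    then have "c *\<^sub>R \<rho> = d *\<^sub>R \<rho>" using \<rho>(2) \<sigma>(2) by metis
    then show ?thesis using nst_nonzero[OF \<rho>(1)] by (simp only: scaleR_cancel_right) simp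
  qed
qed

lemma ident_pure: "pure T A A (idn A)"
  unfolding pure_def
proof (intro conjI ballI allI impI)
  show "idn A \<in> hom A A" by simp
  fix Ds J j assume Ds: "Ds \<in> tests T A A" and J: "J \<subseteq> {..<length Ds}"
    and eq: "idn A = (\<Sum>j\<in>J. Ds ! j)" and j: "j \<in> J"
  let ?D = "Ds ! j"
  have h: "Ds ! i \<in> hom A A" if "i \<in> J" for i using Ds J that by (rule test_nth_hom)
  note D = h[OF j]
  have fin: "finite J" using J finite_subset by blast
  have DE: "?D \<otimes> idn E \<in> hom (A \<star> E) (A \<star> E)" for E using par_hom[OF D ident_hom] .
  have pure_eig: "\<exists>c\<ge>0. (?D \<otimes> idn E) \<odot> \<Psi> = c *\<^sub>R \<Psi>" if \<Psi>: "pure T I (A \<star> E) \<Psi>" for E \<Psi>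
  proof -
    let ?Gs = "map (\<lambda>D. D \<otimes> idn E) Ds"
    have Gs: "?Gs \<in> tests T (A \<star> E) (A \<star> E)"
      using tests_par[OF Ds channel_test[OF ident_channel[of E]]] by simp
    have hE: "Ds ! i \<otimes> idn E \<in> hom (A \<star> E) (A \<star> E)" if "i \<in> J" for i
      using par_hom[OF h[OF that] ident_hom] .
    have "(\<Sum>j\<in>J. (?Gs ! j) \<odot> \<Psi>) = (\<Sum>j\<in>J. (Ds ! j \<otimes> idn E) \<odot> \<Psi>)"
      using J by (intro sum.cong) auto
    also have "\<dots> = (\<Sum>j\<in>J. Ds ! j \<otimes> idn E) \<odot> \<Psi>"
      using seq_sum_left[of J "\<lambda>i. Ds ! i \<otimes> idn E" "A \<star> E" "A \<star> E" \<Psi> I] hE fin pure_hom[OF \<Psi>]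
      by (simp add: hom_span)
    also have "(\<Sum>j\<in>J. Ds ! j \<otimes> idn E) = (\<Sum>j\<in>J. Ds ! j) \<otimes> idn E"
      using par_sum_left[of J "\<lambda>i. Ds ! i" A A "idn E" E E] h fin by (simp add: hom_span)
    also have "\<dots> = idn (A \<star> E)" by (simp only: eq[symmetric] ident_tensor[rule_format])
    finally have s: "(\<Sum>j\<in>J. (?Gs ! j) \<odot> \<Psi>) = \<Psi>" using pure_hom[OF \<Psi>] by simp
    have "j < length Ds" using J j by blast
    then have nth: "?Gs ! j = ?D \<otimes> idn E" and J': "J \<subseteq> {..<length ?Gs}" using J by simp_all
    show ?thesis
      using pure_refinement[OF _ pure_hom[OF \<Psi>] Gs J' j] \<Psi> unfolding s nth by blast
  qed
  have eig: "\<exists>c\<ge>0. (?D \<otimes> idn E) \<odot> \<rho> = c *\<^sub>R \<rho>" if \<rho>: "\<rho> \<in> nst (A \<star> E)" for E \<rho>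
  proof -
    obtain B \<Psi> where \<Psi>: "pure T I ((A \<star> E) \<star> B) \<Psi>" "(idn (A \<star> E) \<otimes> u B) \<odot> \<Psi> = \<rho>"
      using purification_exists[OF \<rho>] by metis
    have \<Psi>': "\<Psi> \<in> hom I (A \<star> (E \<star> B))" using pure_hom[OF \<Psi>(1)] by simp
    obtain c where c: "c \<ge> 0" "(?D \<otimes> idn (E \<star> B)) \<odot> \<Psi> = c *\<^sub>R \<Psi>"
      using pure_eig[of "E \<star> B" \<Psi>] \<Psi>(1) by auto
    have "idn (A \<star> E) \<otimes> u B \<in> hom (A \<star> (E \<star> B)) (A \<star> E)"
      using par_hom[OF ident_hom[of "A \<star> E"] u_hom[of B]] by simp
    then have "(?D \<otimes> idn E) \<odot> \<rho> = c *\<^sub>R \<rho>"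
      using par_contract_commute[OF D u_hom[of B] \<Psi>'] c(2) \<Psi>(2) \<Psi>'
      by (simp add: seq_scale_right[of _ I "A \<star> (E \<star> B)" _ "A \<star> E"] hom_span)
    with c(1) show ?thesis by blast
  qed
  obtain \<sigma> where \<sigma>: "\<sigma> \<in> nst A" using nst_exists by blast
  then obtain c where c: "c \<ge> 0" "?D \<odot> \<sigma> = c *\<^sub>R \<sigma>"
    using eig[of \<sigma> I] D by (auto simp: par_unit(2)[of _ A A])
  have const: "(?D \<otimes> idn E) \<odot> \<rho> = c *\<^sub>R \<rho>" if \<rho>: "\<rho> \<in> nst (A \<star> E)" for E \<rho>
  proof -
    obtain d where d: "(?D \<otimes> idn E) \<odot> \<rho> = d *\<^sub>R \<rho>" using eig[OF \<rho>] by blast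
    obtain \<tau> where \<tau>: "\<tau> \<in> nst E" using nst_exists by blast
    have "(?D \<otimes> idn E) \<odot> (\<sigma> \<otimes> \<tau>) = (?D \<odot> \<sigma>) \<otimes> (idn E \<odot> \<tau>)"
      using interchange[OF nst_hom[OF \<sigma>] D nst_hom[OF \<tau>] ident_hom[of E]] by simp
    also have "\<dots> = c *\<^sub>R (\<sigma> \<otimes> \<tau>)"
      using c(2) nst_hom[OF \<sigma>] nst_hom[OF \<tau>] by (simp add: par_scale_left[of _ I A _ I E] hom_span)
    finally have "d = c"
      using eigenvalue_unique[OF DE _ \<rho> d nst_par[OF \<sigma> \<tau>]] eig by blast
    with d show ?thesis by simp
  qed
  have all: "(?D \<otimes> idn E) \<odot> \<rho> = c *\<^sub>R \<rho>" if \<rho>: "\<rho> \<in> hom I (A \<star> E)" for E \<rho>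
  proof -
    obtain F C e where C: "C \<in> nst ((A \<star> E) \<star> F)" "e \<in> hom F I" "\<rho> = (idn (A \<star> E) \<otimes> e) \<odot> C"
      using state_realization[OF \<rho>] by blast
    have C': "C \<in> nst (A \<star> (E \<star> F))" using C(1) by simp
    have "idn (A \<star> E) \<otimes> e \<in> hom (A \<star> (E \<star> F)) (A \<star> E)"
      using par_hom[OF ident_hom[of "A \<star> E"] C(2)] by simp
    then show ?thesis
      using par_contract_commute[OF D C(2) nst_hom[OF C']] const[OF C'] C(3) nst_hom[OF C']
      by (simp add: seq_scale_right[of _ I "A \<star> (E \<star> F)" _ "A \<star> E"] hom_span)
  qed
  have "?D = c *\<^sub>R idn A"
  proof -
    have eqs: "ev b ((?D \<otimes> idn E) \<odot> \<rho>) = ev b (((c *\<^sub>R idn A) \<otimes> idn E) \<odot> \<rho>)"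
      if "\<rho> \<in> states T (A \<star> E)" for E \<rho> b
    proof -
      have "(c *\<^sub>R idn A) \<otimes> idn E = c *\<^sub>R idn (A \<star> E)"
        by (simp add: par_scale_left[of _ A A _ E E] hom_span ident_tensor[rule_format])
      then have "((c *\<^sub>R idn A) \<otimes> idn E) \<odot> \<rho> = c *\<^sub>R \<rho>"
        using that seq_scale_left[of "idn (A \<star> E)" "A \<star> E" "A \<star> E" \<rho> I c] by (simp add: hom_span)
      then show ?thesis using all that by simp
    qed
    have "?D \<in> span (hom A A)" "c *\<^sub>R idn A \<in> span (hom A A)"
      using D by (simp_all add: hom_span span_scale)
    with eqs show ?thesis using op_equiv by blast
  qed
  with c(1) show "\<exists>p\<ge>0. Ds ! j = p *\<^sub>R idn A" by blast
qed

lemma pure_transitive: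
  assumes "pure T I A \<alpha>" "\<alpha> \<in> nst A" "pure T I A \<beta>" "\<beta> \<in> nst A"
  obtains U V where "U \<in> channels T A A" "V \<in> channels T A A" "V \<odot> U = idn A" "U \<odot> V = idn A" "\<beta> = U \<odot> \<alpha>"
proof -
  have "u A \<odot> \<gamma> = idn I" if "\<gamma> \<in> nst A" for \<gamma>
    using ev_scalar[of "u A" A \<gamma>] that by (simp add: hom_span nst_iff)
  then have eq: "(idn I \<otimes> u A) \<odot> \<alpha> = (idn I \<otimes> u A) \<odot> \<beta>" using assms by (simp add: par_unit(1)[of _ A I])
  have "pure T I (I \<star> A) \<alpha>" "\<alpha> \<in> nst (I \<star> A)" "pure T I (I \<star> A) \<beta>" "\<beta> \<in> nst (I \<star> A)"
    using assms by simp_all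
  from purification_unique[OF this eq] obtain U V where
    *: "U \<in> channels T A A" "V \<in> channels T A A" "V \<odot> U = idn A" "U \<odot> V = idn A" "\<beta> = (idn I \<otimes> U) \<odot> \<alpha>" .
  then show thesis using that[of U V] par_unit(1)[OF channel_hom[OF *(1)]] by simp
qed

lemma swap_triv: "swap T I I = idn I"
  using det_eff_unique[of "swap T I I" I] swap_channel[rule_format, of I I] by simp

lemma effect_swap: "a \<in> hom A I \<Longrightarrow> b \<in> hom B I \<Longrightarrow> (b \<otimes> a) \<odot> swap T A B = a \<otimes> b"
  using swap_natural[of a A I b B I] par_effect[of a A b B] by (simp add: swap_triv)

lemma ev_swap: "a \<in> hom A I \<Longrightarrow> b \<in> hom B I \<Longrightarrow> \<Psi> \<in> hom I (A \<star> B) \<Longrightarrow>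
    ev (b \<otimes> a) (swap T A B \<odot> \<Psi>) = ev (a \<otimes> b) \<Psi>"
  using ev_seq[OF swap_hom _ par_effect[of b B a A]] by (simp add: effect_swap)

lemma pure_swap: "pure T I (A \<star> B) \<Psi> \<Longrightarrow> pure T I (B \<star> A) (swap T A B \<odot> \<Psi>)"
  using pure_reversible_state[of "swap T A B" "A \<star> B" "B \<star> A" "swap T B A"] swap_channel by blast

lemma nst_swap: "\<Psi> \<in> nst (A \<star> B) \<Longrightarrow> swap T A B \<odot> \<Psi> \<in> nst (B \<star> A)"
  using channel_apply_nst swap_channel by blast

lemma ev_par_add_left: "x \<in> span (hom A I) \<Longrightarrow> y \<in> span (hom A I) \<Longrightarrow> b \<in> hom B I \<Longrightarrow> \<Psi> \<in> hom I (A \<star> B) \<Longrightarrow>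
    ev ((x + y) \<otimes> b) \<Psi> = ev (x \<otimes> b) \<Psi> + ev (y \<otimes> b) \<Psi>"
  using par_span[of x A I b B I] par_span[of y A I b B I]
  by (simp add: par_add_left[of _ A I _ _ B I] hom_span ev_add_left[of _ "A \<star> B"])

lemma ev_par_add_right: "x \<in> span (hom B I) \<Longrightarrow> y \<in> span (hom B I) \<Longrightarrow> a \<in> hom A I \<Longrightarrow> \<Psi> \<in> hom I (A \<star> B) \<Longrightarrow>
    ev (a \<otimes> (x + y)) \<Psi> = ev (a \<otimes> x) \<Psi> + ev (a \<otimes> y) \<Psi>"
  using par_span[of a A I x B I] par_span[of a A I y B I]
  by (simp add: par_add_right[of _ B I _ _ A I] hom_span ev_add_left[of _ "A \<star> B"])

lemma ev_par_mono_left: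
  assumes "a \<in> hom A I" "b \<in> hom B I" "\<Psi> \<in> hom I (A \<star> B)"
  shows "ev (a \<otimes> b) \<Psi> \<le> ev (u A \<otimes> b) \<Psi>"
  using assms by (intro functional_le_det_eff[where \<phi> = "\<lambda>a. ev (a \<otimes> b) \<Psi>"])
    (auto simp: ev_par_add_left[of _ A _ _ B] intro!: ev_bounds(1) par_effect)

lemma ev_par_mono_right:
  assumes "a \<in> hom A I" "b \<in> hom B I" "\<Psi> \<in> hom I (A \<star> B)"
  shows "ev (a \<otimes> b) \<Psi> \<le> ev (a \<otimes> u B) \<Psi>"
  using assms by (intro functional_le_det_eff[where \<phi> = "\<lambda>b. ev (a \<otimes> b) \<Psi>"])
    (auto simp: ev_par_add_right[of _ B _ _ A] intro!: ev_bounds(1) par_effect)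

lemma sharp_par:
  assumes a: "a \<in> hom A I" and \<Psi>: "\<Psi> \<in> hom I (A \<star> B)" and b: "b \<in> hom B I"
    and eq: "ev (a \<otimes> u B) \<Psi> = ev (u A \<otimes> u B) \<Psi>"
  shows "ev (a \<otimes> b) \<Psi> = ev (u A \<otimes> b) \<Psi>"
proof (rule antisym)
  show "ev (a \<otimes> b) \<Psi> \<le> ev (u A \<otimes> b) \<Psi>" using a b \<Psi> by (rule ev_par_mono_left)
  have "ev (a \<otimes> u B) \<Psi> - ev (a \<otimes> b) \<Psi> \<le> ev (u A \<otimes> u B) \<Psi> - ev (u A \<otimes> b) \<Psi>"
    using a b \<Psi>
    by (intro functional_le_det_eff[where \<phi> = "\<lambda>a. ev (a \<otimes> u B) \<Psi> - ev (a \<otimes> b) \<Psi>"])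
      (auto simp: ev_par_add_left[of _ A _ _ B] intro!: ev_par_mono_right)
  then show "ev (u A \<otimes> b) \<Psi> \<le> ev (a \<otimes> b) \<Psi>" using eq by simp
qed

lemma sharp_contract_pure:
  assumes a: "pure T A I a" and \<Psi>: "pure T I (A \<star> B) \<Psi>" "\<Psi> \<in> nst (A \<star> B)" and eq: "ev (a \<otimes> u B) \<Psi> = 1"
  shows "pure T I B ((a \<otimes> idn B) \<odot> \<Psi>)" "(a \<otimes> idn B) \<odot> \<Psi> \<in> nst B"
    "\<And>b. b \<in> hom B I \<Longrightarrow> ev b ((a \<otimes> idn B) \<odot> \<Psi>) = ev (u A \<otimes> b) \<Psi>"
proof -
  note h = pure_hom[OF a] nst_hom[OF \<Psi>(2)]
  show "pure T I B ((a \<otimes> idn B) \<odot> \<Psi>)"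
    using pure_seq[OF \<Psi>(1), of B "a \<otimes> idn B"] pure_par[OF a ident_pure[of B]] by simp
  show *: "ev b ((a \<otimes> idn B) \<odot> \<Psi>) = ev (u A \<otimes> b) \<Psi>" if "b \<in> hom B I" for b
    using ev_contract_left[OF h(2,1) that] sharp_par[OF h that] eq nst_u[OF \<Psi>(2)] by (simp add: u_tensor)
  show "(a \<otimes> idn B) \<odot> \<Psi> \<in> nst B"
    using *[of "u B"] nst_u[OF \<Psi>(2)] contract_left_hom[OF h(2,1)] by (simp add: nst_iff u_tensor)
qed

text \<open>Steering a purification of \<open>\<rho>\<close> by \<open>a\<close> shows that its other marginal \<open>\<beta>\<close> is pure.  The product
  \<open>\<beta> \<otimes> \<alpha>0\<close> also purifies \<open>\<beta>\<close>, so \<open>\<rho>\<close> is a reversible image of \<open>\<alpha>0\<close>.\<close>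
lemma sharp_state_pure_aux:
  assumes \<alpha>0: "pure T I A \<alpha>0" "\<alpha>0 \<in> nst A" and a: "pure T A I a" and \<rho>: "\<rho> \<in> hom I A" "ev a \<rho> = 1"
  shows "pure T I A \<rho>"
proof -
  have n\<rho>: "\<rho> \<in> nst A" using sharp_nst[OF pure_hom[OF a] \<rho>] .
  obtain B \<Psi> where \<Psi>: "pure T I (A \<star> B) \<Psi>" "\<Psi> \<in> nst (A \<star> B)" "(idn A \<otimes> u B) \<odot> \<Psi> = \<rho>"
    using purification_exists[OF n\<rho>] .
  note h\<Psi> = nst_hom[OF \<Psi>(2)]
  have ev\<rho>: "ev e \<rho> = ev (e \<otimes> u B) \<Psi>" if "e \<in> hom A I" for e
    using ev_contract_right[OF h\<Psi> u_hom that] \<Psi>(3) by simp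
  define \<beta> where "\<beta> = (a \<otimes> idn B) \<odot> \<Psi>"
  have "ev (a \<otimes> u B) \<Psi> = 1" using ev\<rho>[OF pure_hom[OF a]] \<rho>(2) by simp
  note \<beta> = sharp_contract_pure[OF a \<Psi>(1,2) this, folded \<beta>_def]
  let ?\<Psi>' = "swap T A B \<odot> \<Psi>"
  note s = pure_swap[OF \<Psi>(1)] nst_swap[OF \<Psi>(2)]
  have p: "pure T I (B \<star> A) (\<beta> \<otimes> \<alpha>0)" using pure_par[OF \<beta>(1) \<alpha>0(1)] by simp
  note n = nst_par[OF \<beta>(2) \<alpha>0(2)]
  have "(idn B \<otimes> u A) \<odot> (\<beta> \<otimes> \<alpha>0) = (idn B \<otimes> u A) \<odot> ?\<Psi>'"
  proof (rule state_eqI[of _ B])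
    show "(idn B \<otimes> u A) \<odot> (\<beta> \<otimes> \<alpha>0) \<in> span (hom I B)" "(idn B \<otimes> u A) \<odot> ?\<Psi>' \<in> span (hom I B)"
      using contract_right_hom[OF nst_hom[OF n] u_hom] contract_right_hom[OF nst_hom[OF s(2)] u_hom]
      by (simp_all add: hom_span)
    fix b assume b: "b \<in> hom B I"
    have "ev b ((idn B \<otimes> u A) \<odot> (\<beta> \<otimes> \<alpha>0)) = ev b \<beta>"
      using ev_contract_right[OF nst_hom[OF n] u_hom b] ev_par[OF b u_hom nst_hom[OF \<beta>(2)] nst_hom[OF \<alpha>0(2)]]
        nst_u[OF \<alpha>0(2)] by simp
    also have "\<dots> = ev b ((idn B \<otimes> u A) \<odot> ?\<Psi>')"
      using ev_contract_right[OF nst_hom[OF s(2)] u_hom b] ev_swap[OF u_hom b h\<Psi>] \<beta>(3)[OF b] by simp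
    finally show "ev b ((idn B \<otimes> u A) \<odot> (\<beta> \<otimes> \<alpha>0)) = ev b ((idn B \<otimes> u A) \<odot> ?\<Psi>')" .
  qed
  from purification_unique[OF p n s this] obtain U V where
    U: "U \<in> channels T A A" "V \<in> channels T A A" "V \<odot> U = idn A" "U \<odot> V = idn A"
      "?\<Psi>' = (idn B \<otimes> U) \<odot> (\<beta> \<otimes> \<alpha>0)" .
  have hU: "U \<odot> \<alpha>0 \<in> hom I A" using channel_apply_nst[OF U(1) \<alpha>0(2)] nst_hom by blast
  have "\<rho> = U \<odot> \<alpha>0"
  proof (rule state_eqI[of _ A])
    show "\<rho> \<in> span (hom I A)" "U \<odot> \<alpha>0 \<in> span (hom I A)" using \<rho>(1) hU by (simp_all add: hom_span)
    fix e assume e: "e \<in> hom A I"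
    have eU: "e \<odot> U \<in> hom A I" using seq_hom[OF channel_hom[OF U(1)] e] .
    have "ev e \<rho> = ev (u B \<otimes> e) ?\<Psi>'" using ev\<rho>[OF e] ev_swap[OF e u_hom h\<Psi>] by simp
    also have "\<dots> = ev (u B \<otimes> (e \<odot> U)) (\<beta> \<otimes> \<alpha>0)"
      using ev_apply_right[OF nst_hom[OF n] channel_hom[OF U(1)] u_hom e] U(5) by simp
    also have "\<dots> = ev e (U \<odot> \<alpha>0)"
      using ev_par[OF u_hom eU nst_hom[OF \<beta>(2)] nst_hom[OF \<alpha>0(2)]] nst_u[OF \<beta>(2)]
        ev_seq[OF channel_hom[OF U(1)] nst_hom[OF \<alpha>0(2)] e] by simp
    finally show "ev e \<rho> = ev e (U \<odot> \<alpha>0)" .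
  qed
  then show ?thesis using pure_reversible_state[OF U(1-4) \<alpha>0(1)] by simp
qed

lemma sharp_effect_exists:
  assumes \<beta>: "pure T I B \<beta>" "\<beta> \<in> nst B"
  obtains b where "pure T B I b" "ev b \<beta> = 1"
proof -
  obtain b \<tau> where b: "pure T B I b" "\<tau> \<in> hom I B" "ev b \<tau> = 1"
    using sharpness unfolding pure_sharpness_def by (metis states_eq)
  have "pure T I B \<tau>" using sharp_state_pure_aux[OF \<beta> b] .
  moreover have "\<tau> \<in> nst B" using sharp_nst[OF pure_hom[OF b(1)] b(2,3)] .
  ultimately obtain U V where U: "U \<in> channels T B B" "V \<in> channels T B B" "V \<odot> U = idn B" "U \<odot> V = idn B"
    "\<tau> = U \<odot> \<beta>" using pure_transitive[OF \<beta>] by metis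
  have "ev (b \<odot> U) \<beta> = 1"
    using ev_seq[OF channel_hom[OF U(1)] nst_hom[OF \<beta>(2)] pure_hom[OF b(1)]] b(3) U(5) by simp
  then show thesis using that pure_reversible_effect[OF U(1-4) b(1)] by blast
qed

lemma pure_state_exists: "\<exists>\<alpha>. pure T I A \<alpha> \<and> \<alpha> \<in> nst A"
proof -
  obtain a \<rho> where a: "pure T A I a" "\<rho> \<in> hom I A" "ev a \<rho> = 1"
    using sharpness unfolding pure_sharpness_def by (metis states_eq)
  have n\<rho>: "\<rho> \<in> nst A" using sharp_nst[OF pure_hom[OF a(1)] a(2,3)] .
  obtain B \<Psi> where \<Psi>: "pure T I (A \<star> B) \<Psi>" "\<Psi> \<in> nst (A \<star> B)" "(idn A \<otimes> u B) \<odot> \<Psi> = \<rho>"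
    using purification_exists[OF n\<rho>] .
  note h\<Psi> = nst_hom[OF \<Psi>(2)]
  have "ev (a \<otimes> u B) \<Psi> = 1"
    using ev_contract_right[OF h\<Psi> u_hom pure_hom[OF a(1)]] \<Psi>(3) a(3) by simp
  note \<beta> = sharp_contract_pure[OF a(1) \<Psi>(1,2) this]
  obtain b where b: "pure T B I b" "ev b ((a \<otimes> idn B) \<odot> \<Psi>) = 1"
    using sharp_effect_exists[OF \<beta>(1,2)] .
  have "pure T I A ((idn A \<otimes> b) \<odot> \<Psi>)"
    using pure_seq[OF \<Psi>(1), of A "idn A \<otimes> b"] pure_par[OF ident_pure[of A] b(1)] by simp
  moreover have "(idn A \<otimes> b) \<odot> \<Psi> \<in> nst A"
    using ev_contract_right[OF h\<Psi> pure_hom[OF b(1)] u_hom] \<beta>(3)[OF pure_hom[OF b(1)]] b(2)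
      contract_right_hom[OF h\<Psi> pure_hom[OF b(1)]] by (simp add: nst_iff)
  ultimately show ?thesis by blast
qed

lemma sharp_state_pure:
  assumes "pure T A I a" "\<rho> \<in> hom I A" "ev a \<rho> = 1"
  shows "pure T I A \<rho>"
  using sharp_state_pure_aux[OF _ _ assms] pure_state_exists by blast

lemma separating_effect:
  assumes "\<epsilon>0 \<in> nst E" "\<epsilon>1 \<in> nst E" "\<epsilon>0 \<noteq> \<epsilon>1"
  obtains c where "c \<in> hom E I" "ev c \<epsilon>0 \<noteq> ev c \<epsilon>1"
  using state_eqI[of \<epsilon>0 E \<epsilon>1] assms by (meson hom_span nst_hom)

text \<open>Tests need not be closed under classical randomisation, so the two summands are first put into
  a common test: a system with two different states serves as an (imperfect) flag.\<close>
lemma pure_extremal: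
  assumes \<epsilon>: "\<epsilon>0 \<in> nst E" "\<epsilon>1 \<in> nst E" "\<epsilon>0 \<noteq> \<epsilon>1"
    and x: "pure T I A x" and s: "s \<in> hom I A" "s' \<in> hom I A" and sum: "s + s' = l *\<^sub>R x" "0 \<le> l" "l \<le> 2"
  shows "\<exists>c. s = c *\<^sub>R x"
proof -
  obtain c where c: "c \<in> hom E I" "ev c \<epsilon>0 \<noteq> ev c \<epsilon>1" using separating_effect[OF \<epsilon>] .
  let ?\<Theta> = "(1/2) *\<^sub>R (s \<otimes> \<epsilon>0) + (1/2) *\<^sub>R (s' \<otimes> \<epsilon>1)"
  note h\<epsilon> = nst_hom[OF \<epsilon>(1)] nst_hom[OF \<epsilon>(2)]
  have \<Theta>: "?\<Theta> \<in> hom I (A \<star> E)" using hom_half[OF par_state[OF s(1) h\<epsilon>(1)] par_state[OF s(2) h\<epsilon>(2)]] .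
  have contract: "(idn A \<otimes> e) \<odot> ?\<Theta> = (ev e \<epsilon>0 / 2) *\<^sub>R s + (ev e \<epsilon>1 / 2) *\<^sub>R s'" if e: "e \<in> hom E I" for e
  proof (rule state_eqI[of _ A])
    show "(idn A \<otimes> e) \<odot> ?\<Theta> \<in> span (hom I A)" using contract_right_hom[OF \<Theta> e] by (rule hom_span)
    show "(ev e \<epsilon>0 / 2) *\<^sub>R s + (ev e \<epsilon>1 / 2) *\<^sub>R s' \<in> span (hom I A)"
      using s by (simp add: span_add span_scale hom_span)
    fix b assume b: "b \<in> hom A I"
    have "ev b ((idn A \<otimes> e) \<odot> ?\<Theta>) = (ev (b \<otimes> e) (s \<otimes> \<epsilon>0) + ev (b \<otimes> e) (s' \<otimes> \<epsilon>1)) / 2"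
      using ev_contract_right[OF \<Theta> e b]
        ev_half[OF par_effect[OF b e] par_state[OF s(1) h\<epsilon>(1)] par_state[OF s(2) h\<epsilon>(2)]] by simp
    also have "\<dots> = ev b ((ev e \<epsilon>0 / 2) *\<^sub>R s + (ev e \<epsilon>1 / 2) *\<^sub>R s')"
      using b s ev_par[OF b e s(1) h\<epsilon>(1)] ev_par[OF b e s(2) h\<epsilon>(2)]
      by (simp add: ev_add_right[of _ A] ev_scale_right[of _ A] hom_span span_scale field_simps)
    finally show "ev b ((idn A \<otimes> e) \<odot> ?\<Theta>) = ev b ((ev e \<epsilon>0 / 2) *\<^sub>R s + (ev e \<epsilon>1 / 2) *\<^sub>R s')" .
  qed
  have "(idn A \<otimes> u E) \<odot> ?\<Theta> = (1/2) *\<^sub>R (s + s')"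
    using contract[OF u_hom] nst_u[OF \<epsilon>(1)] nst_u[OF \<epsilon>(2)] by (simp add: scaleR_add_right)
  then have m: "(idn A \<otimes> u E) \<odot> ?\<Theta> = (l/2) *\<^sub>R x" using sum(1) by simp
  have "pure T I A ((l/2) *\<^sub>R x)" using pure_scale[OF x, of "l/2"] sum by simp
  then obtain k where k: "(idn A \<otimes> c) \<odot> ?\<Theta> = k *\<^sub>R ((l/2) *\<^sub>R x)"
    using pure_marginal_contract[OF \<Theta> _ c(1)] unfolding m by auto
  have s': "s' = l *\<^sub>R x - s" using sum(1) by (simp add: algebra_simps)
  have "(ev c \<epsilon>0 / 2) *\<^sub>R s + (ev c \<epsilon>1 / 2) *\<^sub>R (l *\<^sub>R x - s) = (k * l / 2) *\<^sub>R x"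
    using contract[OF c(1)] k unfolding s' by simp
  then have rel: "((ev c \<epsilon>0 - ev c \<epsilon>1) / 2) *\<^sub>R s = (k * l / 2 - ev c \<epsilon>1 / 2 * l) *\<^sub>R x"
    by (simp add: algebra_simps diff_divide_distrib)
  define d m where "d = (ev c \<epsilon>0 - ev c \<epsilon>1) / 2" and "m = k * l / 2 - ev c \<epsilon>1 / 2 * l"
  have "d *\<^sub>R s = m *\<^sub>R x" using rel by (simp only: d_def m_def)
  then have "(1 / d) *\<^sub>R (d *\<^sub>R s) = (1 / d) *\<^sub>R (m *\<^sub>R x)" by simp
  moreover have "d \<noteq> 0" using c(2) by (simp add: d_def)
  ultimately have "s = (m / d) *\<^sub>R x" by simp
  then show ?thesis by blast
qed

lemma sharp_state_unique:
  assumes a: "pure T A I a" and \<alpha>: "\<alpha> \<in> hom I A" "ev a \<alpha> = 1" and \<beta>: "\<beta> \<in> hom I A" "ev a \<beta> = 1"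
  shows "\<alpha> = \<beta>"
proof (rule ccontr)
  assume ne: "\<alpha> \<noteq> \<beta>"
  let ?m = "(1/2) *\<^sub>R \<alpha> + (1/2) *\<^sub>R \<beta>"
  note ha = pure_hom[OF a]
  have n: "\<alpha> \<in> nst A" "\<beta> \<in> nst A" using sharp_nst[OF ha] \<alpha> \<beta> by blast+
  have "ev a ?m = 1" using ev_half[OF ha \<alpha>(1) \<beta>(1)] \<alpha> \<beta> by simp
  then have pm: "pure T I A ?m" using sharp_state_pure[OF a hom_half[OF \<alpha>(1) \<beta>(1)]] by blast
  have hs: "(1/2) *\<^sub>R \<alpha> \<in> hom I A" "(1/2) *\<^sub>R \<beta> \<in> hom I A"
    using scale_state(1)[OF \<alpha>(1), of "1/2"] scale_state(1)[OF \<beta>(1), of "1/2"] by simp_all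
  obtain c where c: "(1/2) *\<^sub>R \<alpha> = c *\<^sub>R ?m" using pure_extremal[OF n ne pm hs, of 1] by auto
  from arg_cong[OF c, of "ev (u A)"] have "c = 1/2"
    using n nst_half[OF n] \<alpha>(1) hom_half[OF \<alpha>(1) \<beta>(1)]
    by (simp add: ev_scale_right[of _ A] hom_span nst_iff)
  then have "(1/2) *\<^sub>R \<alpha> = (1/2) *\<^sub>R ?m" using c by (simp only:)
  then have "\<alpha> = ?m" unfolding scaleR_cancel_left by simp
  then have "(1/2) *\<^sub>R \<alpha> = (1/2) *\<^sub>R \<beta>" by (metis add_diff_cancel_left' add.commute real_vector.scale_one field_sum_of_halves scaleR_add_left)
  then show False using ne by simp
qed

subsection \<open>Pure states determine effects\<close>

lemma ev_assoc4:
  assumes "h \<in> hom R I" "a \<in> hom A I" "b \<in> hom B I" "f \<in> hom G I"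
  shows "(h \<otimes> (a \<otimes> b)) \<otimes> f = h \<otimes> (a \<otimes> (b \<otimes> f))"
  using par_assoc[OF assms(1) par_effect[OF assms(2,3)] assms(4)] par_assoc[OF assms(2-4)] by simp

text \<open>The state \<open>\<Omega>\<close> dilates the channel that either appends \<open>\<alpha> \<otimes> \<epsilon>0\<close> to its input or appends
  \<open>\<alpha> \<otimes> \<epsilon>1\<close> and swaps \<open>\<alpha>\<close> with the input, with equal probabilities.\<close>
lemma swap_dilation:
  assumes \<Gamma>: "pure T I (R \<star> A) \<Gamma>" "\<Gamma> \<in> nst (R \<star> A)" and \<alpha>: "pure T I A \<alpha>" "\<alpha> \<in> nst A"
    and \<epsilon>: "\<epsilon>0 \<in> nst E" "\<epsilon>1 \<in> nst E"
  obtains F \<Omega> W where "pure T I (R \<star> A \<star> A \<star> E \<star> F) \<Omega>" "\<Omega> \<in> nst (R \<star> A \<star> A \<star> E \<star> F)"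
    "W \<in> hom A (A \<star> A \<star> E \<star> F)" "pure T I (A \<star> A \<star> E \<star> F) (W \<odot> \<alpha>)" "W \<odot> \<alpha> \<in> nst (A \<star> A \<star> E \<star> F)"
    "\<Omega> = (idn R \<otimes> W) \<odot> \<Gamma>"
    "\<And>h b b' c. h \<in> hom R I \<Longrightarrow> b \<in> hom A I \<Longrightarrow> b' \<in> hom A I \<Longrightarrow> c \<in> hom E I \<Longrightarrow>
      ev (h \<otimes> (b \<otimes> (b' \<otimes> (c \<otimes> u F)))) \<Omega> =
        (ev (h \<otimes> b) \<Gamma> * ev b' \<alpha> * ev c \<epsilon>0 + ev (h \<otimes> b') \<Gamma> * ev b \<alpha> * ev c \<epsilon>1) / 2"
proof -
  note h\<Gamma> = nst_hom[OF \<Gamma>(2)] and h\<alpha> = nst_hom[OF \<alpha>(2)] and h\<epsilon> = nst_hom[OF \<epsilon>(1)] nst_hom[OF \<epsilon>(2)]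
  define s1 where "s1 = \<Gamma> \<otimes> \<alpha>"
  define s2 where "s2 = (idn R \<otimes> swap T A A) \<odot> s1"
  have n1: "s1 \<in> nst (R \<star> A \<star> A)" using nst_par[OF \<Gamma>(2) \<alpha>(2)] by (simp add: s1_def)
  have n2: "s2 \<in> nst (R \<star> A \<star> A)"
    unfolding s2_def using channel_par[OF ident_channel[of R] swap_channel[rule_format, THEN conjunct1, of A A]] n1
    by (rule channel_apply_nst)
  have nM: "(1/2) *\<^sub>R (s1 \<otimes> \<epsilon>0) + (1/2) *\<^sub>R (s2 \<otimes> \<epsilon>1) \<in> nst (R \<star> A \<star> A \<star> E)" (is "?M \<in> _")
    using nst_half[OF nst_par[OF n1 \<epsilon>(1)] nst_par[OF n2 \<epsilon>(2)]] by simp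
  obtain F \<Omega> where \<Omega>: "pure T I ((R \<star> A \<star> A \<star> E) \<star> F) \<Omega>" "\<Omega> \<in> nst ((R \<star> A \<star> A \<star> E) \<star> F)"
    "(idn (R \<star> A \<star> A \<star> E) \<otimes> u F) \<odot> \<Omega> = ?M"
    using purification_exists[OF nM] .
  have marg: "ev (h \<otimes> (b \<otimes> (b' \<otimes> (c \<otimes> u F)))) \<Omega> =
        (ev (h \<otimes> b) \<Gamma> * ev b' \<alpha> * ev c \<epsilon>0 + ev (h \<otimes> b') \<Gamma> * ev b \<alpha> * ev c \<epsilon>1) / 2"
    if e: "h \<in> hom R I" "b \<in> hom A I" "b' \<in> hom A I" "c \<in> hom E I" for h b b' c
  proof -
    have hb: "h \<otimes> (b \<otimes> b') \<in> hom (R \<star> A \<star> A) I" using e by (simp add: par_effect)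
    have hc: "(h \<otimes> (b \<otimes> b')) \<otimes> c \<in> hom (R \<star> A \<star> A \<star> E) I" using par_effect[OF hb e(4)] by simp
    have v1: "ev (h \<otimes> (b \<otimes> b')) s1 = ev (h \<otimes> b) \<Gamma> * ev b' \<alpha>"
      if "b \<in> hom A I" "b' \<in> hom A I" for b b'
      using ev_par[OF par_effect[OF e(1) that(1)] that(2) h\<Gamma> h\<alpha>] par_assoc[OF e(1) that]
      by (simp add: s1_def)
    have v2: "ev (h \<otimes> (b \<otimes> b')) s2 = ev (h \<otimes> b') \<Gamma> * ev b \<alpha>"
      using ev_apply_right[OF nst_hom[OF n1] swap_hom e(1) par_effect[OF e(2,3)]] v1[OF e(3,2)]
        effect_swap[OF e(3,2)] by (simp add: s2_def)
    have "h \<otimes> (b \<otimes> (b' \<otimes> (c \<otimes> u F))) = ((h \<otimes> (b \<otimes> b')) \<otimes> c) \<otimes> u F"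
      using par_assoc[OF hb e(4) u_hom[of F]] ev_assoc4[OF e(1-3) par_effect[OF e(4) u_hom[of F]]] by simp
    then have "ev (h \<otimes> (b \<otimes> (b' \<otimes> (c \<otimes> u F)))) \<Omega> = ev ((h \<otimes> (b \<otimes> b')) \<otimes> c) ?M"
      using ev_contract_right[OF nst_hom[OF \<Omega>(2)] u_hom hc] \<Omega>(3) by simp
    also have "\<dots> = (ev ((h \<otimes> (b \<otimes> b')) \<otimes> c) (s1 \<otimes> \<epsilon>0) + ev ((h \<otimes> (b \<otimes> b')) \<otimes> c) (s2 \<otimes> \<epsilon>1)) / 2"
      using ev_half[OF hc] nst_hom[OF nst_par[OF n1 \<epsilon>(1)]] nst_hom[OF nst_par[OF n2 \<epsilon>(2)]] by simp
    also have "\<dots> = (ev (h \<otimes> b) \<Gamma> * ev b' \<alpha> * ev c \<epsilon>0 + ev (h \<otimes> b') \<Gamma> * ev b \<alpha> * ev c \<epsilon>1) / 2"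
      using ev_par[OF hb e(4) nst_hom[OF n1] h\<epsilon>(1)] ev_par[OF hb e(4) nst_hom[OF n2] h\<epsilon>(2)]
        v1[OF e(2,3)] v2 by simp
    finally show ?thesis .
  qed
  obtain \<kappa> where \<kappa>: "pure T I (E \<star> F) \<kappa>" "\<kappa> \<in> nst (E \<star> F)" using pure_state_exists by blast
  define K where "K = \<alpha> \<otimes> \<kappa>"
  let ?X' = "A \<star> E \<star> F"
  let ?X = "A \<star> ?X'"
  have K: "pure T I ?X' K" "K \<in> nst ?X'" using pure_par[OF \<alpha>(1) \<kappa>(1)] nst_par[OF \<alpha>(2) \<kappa>(2)] by (simp_all add: K_def)
  note hK = nst_hom[OF K(2)]
  have p: "pure T I (R \<star> ?X) (\<Gamma> \<otimes> K)" "\<Gamma> \<otimes> K \<in> nst (R \<star> ?X)"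
    using pure_par[OF \<Gamma>(1) K(1)] nst_par[OF \<Gamma>(2) K(2)] by simp_all
  have q: "pure T I (R \<star> ?X) \<Omega>" "\<Omega> \<in> nst (R \<star> ?X)" using \<Omega>(1,2) by simp_all
  have "(idn R \<otimes> u ?X) \<odot> (\<Gamma> \<otimes> K) = (idn R \<otimes> u ?X) \<odot> \<Omega>"
  proof (rule state_eqI[of _ R])
    show "(idn R \<otimes> u ?X) \<odot> (\<Gamma> \<otimes> K) \<in> span (hom I R)" "(idn R \<otimes> u ?X) \<odot> \<Omega> \<in> span (hom I R)"
      using contract_right_hom[OF nst_hom[OF p(2)] u_hom] contract_right_hom[OF nst_hom[OF q(2)] u_hom]
      by (simp_all add: hom_span)
    fix h assume h: "h \<in> hom R I"
    have "h \<otimes> u ?X = (h \<otimes> u A) \<otimes> u ?X'"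
      using par_assoc[OF h u_hom[of A] u_hom[of ?X']] by (simp add: u_tensor)
    then have "ev h ((idn R \<otimes> u ?X) \<odot> (\<Gamma> \<otimes> K)) = ev (h \<otimes> u A) \<Gamma>"
      using ev_contract_right[OF nst_hom[OF p(2)] u_hom h]
        ev_par[OF par_effect[OF h u_hom[of A]] u_hom[of ?X'] h\<Gamma> hK] nst_u[OF K(2)] by simp
    also have "\<dots> = ev h ((idn R \<otimes> u ?X) \<odot> \<Omega>)"
      using ev_contract_right[OF nst_hom[OF q(2)] u_hom h] marg[OF h u_hom u_hom u_hom]
        nst_u[OF \<alpha>(2)] nst_u[OF \<epsilon>(1)] nst_u[OF \<epsilon>(2)] by (simp add: u_tensor)
    finally show "ev h ((idn R \<otimes> u ?X) \<odot> (\<Gamma> \<otimes> K)) = ev h ((idn R \<otimes> u ?X) \<odot> \<Omega>)" .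
  qed
  from purification_unique[OF p q this] obtain U V where
    U: "U \<in> channels T ?X ?X" "V \<in> channels T ?X ?X" "V \<odot> U = idn ?X" "U \<odot> V = idn ?X"
      "\<Omega> = (idn R \<otimes> U) \<odot> (\<Gamma> \<otimes> K)" .
  note hU = channel_hom[OF U(1)]
  have hAK: "idn A \<otimes> K \<in> hom A ?X" using par_hom[OF ident_hom[of A] hK] by simp
  define W where "W = U \<odot> (idn A \<otimes> K)"
  have hW: "W \<in> hom A ?X" unfolding W_def using hAK hU by (rule seq_hom)
  have "W \<odot> \<alpha> = U \<odot> (\<alpha> \<otimes> K)"
    using seq_assoc[OF h\<alpha> hAK hU] par_factor(2)[OF h\<alpha> hK] h\<alpha> by (simp add: W_def)
  moreover have "pure T I ?X (U \<odot> (\<alpha> \<otimes> K))"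
    using pure_reversible_state[OF U(1-4)] pure_par[OF \<alpha>(1) K(1)] by simp
  moreover have "U \<odot> (\<alpha> \<otimes> K) \<in> nst ?X"
    using channel_apply_nst[OF U(1) nst_par[OF \<alpha>(2) K(2)]] .
  moreover have "\<Omega> = (idn R \<otimes> W) \<odot> \<Gamma>"
  proof -
    have "\<Gamma> \<otimes> K = (idn (R \<star> A) \<otimes> K) \<odot> \<Gamma>" using par_factor(2)[OF h\<Gamma> hK] h\<Gamma> by simp
    also have "idn (R \<star> A) \<otimes> K = idn R \<otimes> (idn A \<otimes> K)"
      using par_assoc[OF ident_hom[of R] ident_hom[of A] hK] by (simp only: ident_tensor[rule_format])
    finally have "\<Omega> = (idn R \<otimes> U) \<odot> ((idn R \<otimes> (idn A \<otimes> K)) \<odot> \<Gamma>)" using U(5) by simp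
    also have "\<dots> = ((idn R \<otimes> U) \<odot> (idn R \<otimes> (idn A \<otimes> K))) \<odot> \<Gamma>"
      by (rule seq_assoc[OF h\<Gamma> par_hom[OF ident_hom hAK] par_hom[OF ident_hom hU]])
    also have "(idn R \<otimes> U) \<odot> (idn R \<otimes> (idn A \<otimes> K)) = idn R \<otimes> W"
      using interchange[OF ident_hom[of R] ident_hom[of R] hAK hU] ident_seq[OF ident_hom[of R]]
      by (simp add: W_def)
    finally show ?thesis .
  qed
  ultimately show thesis using that[of F \<Omega> W] q hW marg by simp
qed

lemma biadditive_functional_det_eff:
  fixes F :: "'t \<Rightarrow> 't \<Rightarrow> real"
  assumes left: "\<And>x y e. x \<in> span (hom A I) \<Longrightarrow> y \<in> span (hom A I) \<Longrightarrow> e \<in> hom B I \<Longrightarrow> F (x + y) e = F x e + F y e"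
    and right: "\<And>x y e. x \<in> span (hom B I) \<Longrightarrow> y \<in> span (hom B I) \<Longrightarrow> e \<in> hom A I \<Longrightarrow> F e (x + y) = F e x + F e y"
    and nonneg: "\<And>e e'. e \<in> hom A I \<Longrightarrow> e' \<in> hom B I \<Longrightarrow> 0 \<le> F e e'"
    and a: "a \<in> hom A I" and b: "b \<in> hom B I"
  shows "0 \<le> F (u A) (u B) - F a (u B) - F (u A) b + F a b"
proof -
  have "F (u A) b - F a b \<le> F (u A) (u B) - F a (u B)"
  proof (rule functional_le_det_eff[where \<phi> = "\<lambda>e. F (u A) e - F a e"])
    show "F (u A) (x + y) - F a (x + y) = F (u A) x - F a x + (F (u A) y - F a y)"
      if "x \<in> span (hom B I)" "y \<in> span (hom B I)" for x y
      using right[OF that] a by simp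
    show "0 \<le> F (u A) e - F a e" if "e \<in> hom B I" for e
      using functional_le_det_eff[where \<phi> = "\<lambda>x. F x e", of A a] left nonneg a that by simp
    show "b \<in> hom B I" by (rule b)
  qed
  then show ?thesis by simp
qed

lemma ev_add_second:
  assumes "h \<in> hom R I" "x \<in> span (hom A I)" "y \<in> span (hom A I)" "w \<in> hom B I" "\<Omega> \<in> hom I (R \<star> A \<star> B)"
  shows "ev (h \<otimes> ((x + y) \<otimes> w)) \<Omega> = ev (h \<otimes> (x \<otimes> w)) \<Omega> + ev (h \<otimes> (y \<otimes> w)) \<Omega>"
proof -
  have "(x + y) \<otimes> w = x \<otimes> w + y \<otimes> w" using assms by (simp add: par_add_left[of _ A I _ _ B I] hom_span)
  moreover have "x \<otimes> w \<in> span (hom (A \<star> B) I)" "y \<otimes> w \<in> span (hom (A \<star> B) I)"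
    using par_span[OF assms(2) hom_span[OF assms(4)]] par_span[OF assms(3) hom_span[OF assms(4)]] by simp_all
  ultimately show ?thesis using ev_par_add_right[of "x \<otimes> w" "A \<star> B" "y \<otimes> w" h R \<Omega>] assms by simp
qed

lemma ev_add_third:
  assumes "h \<in> hom R I" "b \<in> hom A I" "x \<in> span (hom B I)" "y \<in> span (hom B I)" "f \<in> hom G I" "\<Omega> \<in> hom I (R \<star> A \<star> B \<star> G)"
  shows "ev (h \<otimes> (b \<otimes> ((x + y) \<otimes> f))) \<Omega> = ev (h \<otimes> (b \<otimes> (x \<otimes> f))) \<Omega> + ev (h \<otimes> (b \<otimes> (y \<otimes> f))) \<Omega>"
proof -
  have hb: "h \<otimes> b \<in> hom (R \<star> A) I" using assms by (simp add: par_effect)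
  have as: "h \<otimes> (b \<otimes> (z \<otimes> f)) = (h \<otimes> b) \<otimes> (z \<otimes> f)" if z: "z \<in> span (hom B I)" for z
  proof -
    let ?P = "{z \<in> span (hom B I). h \<otimes> (b \<otimes> (z \<otimes> f)) = (h \<otimes> b) \<otimes> (z \<otimes> f)}"
    have zf: "w \<otimes> f \<in> span (hom (B \<star> G) I)" if "w \<in> span (hom B I)" for w
      using par_span[OF that hom_span[OF assms(5)]] by simp
    have bzf: "b \<otimes> (w \<otimes> f) \<in> span (hom (A \<star> B \<star> G) I)" if "w \<in> span (hom B I)" for w
      using par_span[OF hom_span[OF assms(2)] zf[OF that]] by simp
    have "span (hom B I) \<subseteq> ?P"
    proof (rule span_minimal)
      show "hom B I \<subseteq> ?P"
      proof
        fix z assume z: "z \<in> hom B I"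
        then show "z \<in> ?P" using par_assoc[OF assms(1,2) par_effect[OF z assms(5)]] by (simp add: hom_span)
      qed
      show "subspace ?P"
      proof (rule subspaceI)
        show "0 \<in> ?P"
          using hb assms by (simp add: span_zero par_zero_left[OF hom_span[OF assms(5)]]
              par_zero_right[OF hom_span[OF assms(1)]] par_zero_right[OF hom_span[OF assms(2)]]
              par_zero_right[OF hom_span[OF hb]])
        show "v + w \<in> ?P" if "v \<in> ?P" "w \<in> ?P" for v w
          using that hb assms zf bzf
          by (simp add: span_add par_add_left[of _ B I _ _ G I] par_add_right[of _ "B \<star> G" I _ _ A I]
              par_add_right[of _ "A \<star> B \<star> G" I _ _ R I] par_add_right[of _ "B \<star> G" I _ _ "R \<star> A" I] hom_span)
        show "k *\<^sub>R v \<in> ?P" if "v \<in> ?P" for k v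
          using that hb assms zf bzf
          by (simp add: span_scale par_scale_left[of _ B I _ G I] par_scale_right[of _ "B \<star> G" I _ A I]
              par_scale_right[of _ "A \<star> B \<star> G" I _ R I] par_scale_right[of _ "B \<star> G" I _ "R \<star> A" I] hom_span)
      qed
    qed
    with z show ?thesis by blast
  qed
  have "\<Omega> \<in> hom I ((R \<star> A) \<star> B \<star> G)" using assms(6) by simp
  from ev_add_second[OF hb assms(3-5) this] show ?thesis
    using as assms(3,4) by (simp add: span_add)
qed

lemma middle_effect:
  assumes "a \<in> hom A I" "b \<in> hom B I" "f \<in> hom G I"
  shows "a \<otimes> (b \<otimes> idn G) \<in> hom (A \<star> B \<star> G) G" "f \<odot> (a \<otimes> (b \<otimes> idn G)) = a \<otimes> (b \<otimes> f)"
proof -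
  have ab: "a \<otimes> b \<in> hom (A \<star> B) I" using assms by (simp add: par_effect)
  have eq: "a \<otimes> (b \<otimes> idn G) = (a \<otimes> b) \<otimes> idn G" using par_assoc[OF assms(1,2) ident_hom[of G]] by simp
  show "a \<otimes> (b \<otimes> idn G) \<in> hom (A \<star> B \<star> G) G"
    unfolding eq using par_hom[OF ab ident_hom[of G]] by simp
  have "f \<odot> ((a \<otimes> b) \<otimes> idn G) = (a \<otimes> b) \<otimes> f" using par_factor(2)[OF ab assms(3)] assms(3) by simp
  then show "f \<odot> (a \<otimes> (b \<otimes> idn G)) = a \<otimes> (b \<otimes> f)" using par_assoc[OF assms] eq by simp
qed

text \<open>The combination of \<open>h0\<close> and \<open>h1\<close> steers \<open>\<Gamma>\<close> to \<open>\<alpha>\<close>; it need not be an effect.\<close>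
lemma sharp_effects_agree:
  assumes a: "pure T A I a1" "pure T A I a2" and \<alpha>: "pure T I A \<alpha>" "\<alpha> \<in> nst A"
    and sharp1: "ev a1 \<alpha> = 1" "ev a2 \<alpha> = 1"
    and \<epsilon>: "\<epsilon>0 \<in> nst E" "\<epsilon>1 \<in> nst E" "\<epsilon>0 \<noteq> \<epsilon>1"
    and \<Gamma>: "pure T I (R \<star> A) \<Gamma>" "\<Gamma> \<in> nst (R \<star> A)"
    and steer: "h0 \<in> hom R I" "h1 \<in> hom R I"
      "\<And>b. b \<in> hom A I \<Longrightarrow> l * ev (h0 \<otimes> b) \<Gamma> + m * ev (h1 \<otimes> b) \<Gamma> = ev b \<alpha>"
    and h: "h \<in> hom R I"
  shows "ev (h \<otimes> a1) \<Gamma> = ev (h \<otimes> a2) \<Gamma>"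
proof -
  obtain F \<Omega> W where \<Omega>: "pure T I (R \<star> A \<star> A \<star> E \<star> F) \<Omega>" "\<Omega> \<in> nst (R \<star> A \<star> A \<star> E \<star> F)"
    and W: "W \<in> hom A (A \<star> A \<star> E \<star> F)"
    and \<pi>: "pure T I (A \<star> A \<star> E \<star> F) (W \<odot> \<alpha>)" "W \<odot> \<alpha> \<in> nst (A \<star> A \<star> E \<star> F)"
    and \<Omega>W: "\<Omega> = (idn R \<otimes> W) \<odot> \<Gamma>"
    and marg: "\<And>h b b' c. h \<in> hom R I \<Longrightarrow> b \<in> hom A I \<Longrightarrow> b' \<in> hom A I \<Longrightarrow> c \<in> hom E I \<Longrightarrow>
      ev (h \<otimes> (b \<otimes> (b' \<otimes> (c \<otimes> u F)))) \<Omega> =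
        (ev (h \<otimes> b) \<Gamma> * ev b' \<alpha> * ev c \<epsilon>0 + ev (h \<otimes> b') \<Gamma> * ev b \<alpha> * ev c \<epsilon>1) / 2"
    using swap_dilation[OF \<Gamma> \<alpha> \<epsilon>(1,2)] by blast
  let ?G = "E \<star> F"
  note ha = pure_hom[OF a(1)] pure_hom[OF a(2)]
  note h\<Omega> = nst_hom[OF \<Omega>(2)] and h\<Gamma> = nst_hom[OF \<Gamma>(2)] and h\<alpha> = nst_hom[OF \<alpha>(2)]
  note uq = nst_u[OF \<alpha>(2)] nst_u[OF \<epsilon>(1)] nst_u[OF \<epsilon>(2)]
  define \<pi> where "\<pi> = W \<odot> \<alpha>"
  note \<pi> = \<pi>[folded \<pi>_def]
  note h\<pi> = nst_hom[OF \<pi>(2)]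
  have uG: "u ?G = u E \<otimes> u F" by (rule u_tensor)
  have cu: "c \<otimes> u F \<in> hom ?G I" if "c \<in> hom E I" for c using par_effect[OF that u_hom] .
  define N where "N h b b' f = ev (h \<otimes> (b \<otimes> (b' \<otimes> f))) \<Omega>" for h b b' f
  define X where "X h b = ev (h \<otimes> b) \<Gamma>" for h b
  have L: "l * ev (h0 \<otimes> q) \<Omega> + m * ev (h1 \<otimes> q) \<Omega> = ev q \<pi>" if q: "q \<in> hom (A \<star> A \<star> ?G) I" for q
    using ev_apply_right[OF h\<Gamma> W steer(1) q] ev_apply_right[OF h\<Gamma> W steer(2) q] steer(3)[OF seq_hom[OF W q]]
      ev_seq[OF W h\<alpha> q] \<Omega>W by (simp add: \<pi>_def)
  have NuG: "N h b b' (c \<otimes> u F) = (X h b * ev c \<epsilon>0 + X h b' * ev c \<epsilon>1) / 2"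
    if "h \<in> hom R I" "b \<in> hom A I" "b' \<in> hom A I" "c \<in> hom E I" "ev b \<alpha> = 1" "ev b' \<alpha> = 1" for h b b' c
    using marg[OF that(1-4)] that(5,6) by (simp add: N_def X_def)
  have Nu: "N h b b' (u ?G) = (X h b + X h b') / 2"
    if "h \<in> hom R I" "b \<in> hom A I" "b' \<in> hom A I" "ev b \<alpha> = 1" "ev b' \<alpha> = 1" for h b b'
    unfolding uG using NuG[OF that(1-3) u_hom that(4,5)] uq by simp
  have Xsteer: "l * X h0 b + m * X h1 b = ev b \<alpha>" if "b \<in> hom A I" for b
    using steer(3)[OF that] by (simp add: X_def)
  have eff: "b \<otimes> (b' \<otimes> f) \<in> hom (A \<star> A \<star> ?G) I" if "b \<in> hom A I" "b' \<in> hom A I" "f \<in> hom ?G I" for b b' f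
    using that by (simp add: par_effect)
  define c where "c f = ev (u A \<otimes> (u A \<otimes> f)) \<pi>" for f
  have c_sharp: "ev (b \<otimes> (b \<otimes> f)) \<pi> = c f"
    if b: "b \<in> hom A I" "ev b \<alpha> = 1" and f: "f \<in> hom ?G I" for b f
  proof -
    have bb: "b \<otimes> b \<in> hom (A \<star> A) I" using b by (simp add: par_effect)
    have h\<pi>': "\<pi> \<in> hom I ((A \<star> A) \<star> ?G)" using h\<pi> by simp
    have "ev ((b \<otimes> b) \<otimes> u ?G) \<pi> = l * N h0 b b (u ?G) + m * N h1 b b (u ?G)"
      using L[OF eff[OF b(1) b(1) u_hom]] par_assoc[OF b(1) b(1) u_hom[of ?G]] by (simp add: N_def)
    also have "\<dots> = 1" using Nu[OF steer(1) b(1) b(1) b(2) b(2)] Nu[OF steer(2) b(1) b(1) b(2) b(2)] Xsteer[OF b(1)] b(2) by simp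
    also have "\<dots> = ev (u (A \<star> A) \<otimes> u ?G) \<pi>" using nst_u[OF \<pi>(2)] u_tensor[of "A \<star> A" ?G] by simp
    finally have "ev ((b \<otimes> b) \<otimes> f) \<pi> = ev (u (A \<star> A) \<otimes> f) \<pi>" using sharp_par[OF bb h\<pi>' f] by simp
    then show ?thesis
      using par_assoc[OF b(1) b(1) f] par_assoc[OF u_hom[of A] u_hom[of A] f] by (simp add: c_def u_tensor)
  qed
  have diag: "N h b b f = c f * X h b"
    if b: "pure T A I b" "ev b \<alpha> = 1" and f: "f \<in> hom ?G I" and h: "h \<in> hom R I" for b f h
  proof -
    note hb = pure_hom[OF b(1)]
    note mid = middle_effect[OF hb hb]
    define S where "S = (idn R \<otimes> (b \<otimes> (b \<otimes> idn ?G))) \<odot> \<Omega>"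
    have S: "S \<in> hom I (R \<star> ?G)" unfolding S_def using apply_right_hom[OF h\<Omega> mid(1)[OF u_hom]] .
    have evS: "ev (h \<otimes> f) S = N h b b f" if "h \<in> hom R I" "f \<in> hom ?G I" for h f
      using ev_apply_right[OF h\<Omega> mid(1)[OF u_hom] that] mid(2)[OF that(2)] by (simp add: S_def N_def)
    have x: "(idn R \<otimes> u ?G) \<odot> S = (idn R \<otimes> b) \<odot> \<Gamma>"
    proof (rule state_eqI[of _ R])
      show "(idn R \<otimes> u ?G) \<odot> S \<in> span (hom I R)" "(idn R \<otimes> b) \<odot> \<Gamma> \<in> span (hom I R)"
        using contract_right_hom[OF S u_hom] contract_right_hom[OF h\<Gamma> hb] by (simp_all add: hom_span)
      fix k assume k: "k \<in> hom R I"
      show "ev k ((idn R \<otimes> u ?G) \<odot> S) = ev k ((idn R \<otimes> b) \<odot> \<Gamma>)"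
        using ev_contract_right[OF S u_hom k] ev_contract_right[OF h\<Gamma> hb k] evS[OF k u_hom]
          Nu[OF k hb hb b(2) b(2)] by (simp add: X_def)
    qed
    have px: "pure T I R ((idn R \<otimes> b) \<odot> \<Gamma>)"
      using pure_seq[OF \<Gamma>(1), of R "idn R \<otimes> b"] pure_par[OF ident_pure[of R] b(1)] by simp
    obtain k where k: "(idn R \<otimes> f) \<odot> S = k *\<^sub>R ((idn R \<otimes> b) \<odot> \<Gamma>)"
      using pure_marginal_contract[OF S _ f] px unfolding x by blast
    have kX: "N h b b f = k * X h b" if h: "h \<in> hom R I" for h
      using ev_contract_right[OF S f h] evS[OF h f] ev_contract_right[OF h\<Gamma> hb h] k
        ev_scale_right[OF hom_span[OF h] hom_span[OF contract_right_hom[OF h\<Gamma> hb]], of k] by (simp add: X_def)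
    have "c f = l * N h0 b b f + m * N h1 b b f"
      using c_sharp[OF hb b(2) f] L[OF eff[OF hb hb f]] by (simp add: N_def)
    also have "\<dots> = k * (l * X h0 b + m * X h1 b)" using kX[OF steer(1)] kX[OF steer(2)] by (simp add: algebra_simps)
    finally have "c f = k" using Xsteer[OF hb] b(2) by simp
    then show ?thesis using kX[OF h] by simp
  qed
  have cross: "N h (u A) (u A) f - N h b (u A) f - N h (u A) b' f + N h b b' f = 0"
    if b: "b \<in> hom A I" "ev b \<alpha> = 1" "b' \<in> hom A I" "ev b' \<alpha> = 1" and f: "f \<in> hom ?G I" and h: "h \<in> hom R I" for b b' f h
  proof -
    have addl: "N k (x + y) e g = N k x e g + N k y e g"
      if "k \<in> hom R I" "x \<in> span (hom A I)" "y \<in> span (hom A I)" "e \<in> hom A I" "g \<in> hom ?G I" for k x y e g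
      using ev_add_second[OF that(1-3) par_effect[OF that(4,5)]] h\<Omega> by (simp add: N_def)
    have addr: "N k e (x + y) g = N k e x g + N k e y g"
      if "k \<in> hom R I" "x \<in> span (hom A I)" "y \<in> span (hom A I)" "e \<in> hom A I" "g \<in> hom ?G I" for k x y e g
      using ev_add_third[OF that(1,4,2,3,5)] h\<Omega> by (simp add: N_def)
    have nonneg: "0 \<le> N k e e' g"
      if "k \<in> hom R I" "e \<in> hom A I" "e' \<in> hom A I" "g \<in> hom ?G I" for k e e' g
      unfolding N_def using ev_bounds(1)[OF par_effect[OF that(1) eff[OF that(2-4)]] h\<Omega>] .
    have mono: "N h e e' f \<le> N (u R) e e' (u ?G)" if e: "e \<in> hom A I" "e' \<in> hom A I" for e e'
    proof -
      have "N h e e' f \<le> N (u R) e e' f"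
        unfolding N_def using ev_par_mono_left[OF h eff[OF e f] h\<Omega>] .
      also have "\<dots> \<le> N (u R) e e' (u ?G)"
        using ev_par_mono_right[of "u R \<otimes> (e \<otimes> e')" "R \<star> A \<star> A" f ?G \<Omega>] e f h\<Omega>
          ev_assoc4[OF u_hom[of R] e f] ev_assoc4[OF u_hom[of R] e u_hom[of ?G]]
        by (simp add: N_def par_effect)
      finally show ?thesis .
    qed
    have "0 \<le> N h (u A) (u A) f - N h b (u A) f - N h (u A) b' f + N h b b' f"
      using biadditive_functional_det_eff[where F = "\<lambda>e e'. N h e e' f", of A A b b'] addl addr nonneg h f b by simp
    moreover have "0 \<le> (N (u R) (u A) (u A) (u ?G) - N h (u A) (u A) f) - (N (u R) b (u A) (u ?G) - N h b (u A) f)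
        - (N (u R) (u A) b' (u ?G) - N h (u A) b' f) + (N (u R) b b' (u ?G) - N h b b' f)"
      using biadditive_functional_det_eff[where F = "\<lambda>e e'. N (u R) e e' (u ?G) - N h e e' f", of A A b b']
        addl addr mono h f b by simp
    moreover have "N (u R) (u A) (u A) (u ?G) - N (u R) b (u A) (u ?G) - N (u R) (u A) b' (u ?G) + N (u R) b b' (u ?G) = 0"
      using Nu[OF u_hom u_hom u_hom uq(1) uq(1)] Nu[OF u_hom b(1) u_hom b(2) uq(1)]
        Nu[OF u_hom u_hom b(3) uq(1) b(4)] Nu[OF u_hom b(1,3,2,4)] by (simp add: field_simps)
    ultimately show ?thesis by linarith
  qed
  define \<epsilon> where "\<epsilon> = (a1 \<otimes> (a1 \<otimes> idn ?G)) \<odot> \<pi>"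
  have p\<epsilon>: "pure T I ?G \<epsilon>"
    unfolding \<epsilon>_def using pure_seq[OF \<pi>(1), of ?G] pure_par[OF a(1) pure_par[OF a(1) ident_pure[of ?G]]] by simp
  have ev\<epsilon>: "ev f \<epsilon> = c f" if f: "f \<in> hom ?G I" for f
    using ev_seq[OF middle_effect(1)[OF ha(1,1) f] h\<pi> f] middle_effect(2)[OF ha(1,1) f] c_sharp[OF ha(1) sharp1(1) f]
    by (simp add: \<epsilon>_def)
  define s where "s b b' = ((h \<otimes> (b \<otimes> b')) \<otimes> idn ?G) \<odot> \<Omega>" for b b'
  have h\<Omega>': "\<Omega> \<in> hom I ((R \<star> A \<star> A) \<star> ?G)" using h\<Omega> by simp
  have hs: "s b b' \<in> hom I ?G" and evs: "\<And>f. f \<in> hom ?G I \<Longrightarrow> ev f (s b b') = N h b b' f"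
    if b: "b \<in> hom A I" "b' \<in> hom A I" for b b'
  proof -
    have e: "h \<otimes> (b \<otimes> b') \<in> hom (R \<star> A \<star> A) I" using h b by (simp add: par_effect)
    show "s b b' \<in> hom I ?G" unfolding s_def using contract_left_hom[OF h\<Omega>' e] .
    show "ev f (s b b') = N h b b' f" if f: "f \<in> hom ?G I" for f
      using ev_contract_left[OF h\<Omega>' e f] ev_assoc4[OF h b f] by (simp add: s_def N_def)
  qed
  have sum: "s a1 a2 + s a2 a1 = (X h a1 + X h a2) *\<^sub>R \<epsilon>"
  proof (rule state_eqI[of _ ?G])
    show "s a1 a2 + s a2 a1 \<in> span (hom I ?G)" "(X h a1 + X h a2) *\<^sub>R \<epsilon> \<in> span (hom I ?G)"
      using hs ha pure_hom[OF p\<epsilon>] by (simp_all add: hom_span span_add span_scale)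
    fix f assume f: "f \<in> hom ?G I"
    have "N h a1 a2 f + N h a2 a1 f = N h a1 a1 f + N h a2 a2 f"
      using cross[OF ha(1) sharp1(1) ha(1) sharp1(1) f h] cross[OF ha(1) sharp1(1) ha(2) sharp1(2) f h]
        cross[OF ha(2) sharp1(2) ha(1) sharp1(1) f h] cross[OF ha(2) sharp1(2) ha(2) sharp1(2) f h] by linarith
    also have "\<dots> = (X h a1 + X h a2) * c f"
      using diag[OF a(1) sharp1(1) f h] diag[OF a(2) sharp1(2) f h] by (simp add: algebra_simps)
    finally show "ev f (s a1 a2 + s a2 a1) = ev f ((X h a1 + X h a2) *\<^sub>R \<epsilon>)"
      using evs[OF ha f] evs[OF ha(2,1) f] ev\<epsilon>[OF f] f hs[OF ha] hs[OF ha(2,1)] pure_hom[OF p\<epsilon>]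
      by (simp add: ev_add_right[of _ ?G] ev_scale_right[of _ ?G] hom_span)
  qed
  have Xb: "0 \<le> X h b" "X h b \<le> 1" if "b \<in> hom A I" for b
    using ev_bounds[OF par_effect[OF h that] h\<Gamma>] by (simp_all add: X_def)
  obtain k where k: "s a1 a2 = k *\<^sub>R \<epsilon>"
    using pure_extremal[OF \<epsilon> p\<epsilon> hs[OF ha] hs[OF ha(2,1)] sum] Xb[OF ha(1)] Xb[OF ha(2)] by auto
  have flag: "X h a1 * ev e \<epsilon>0 + X h a2 * ev e \<epsilon>1 = k * (ev e \<epsilon>0 + ev e \<epsilon>1)" if e: "e \<in> hom E I" for e
  proof -
    have "c (e \<otimes> u F) = l * N h0 (u A) (u A) (e \<otimes> u F) + m * N h1 (u A) (u A) (e \<otimes> u F)"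
      using L[OF eff[OF u_hom u_hom cu[OF e]]] by (simp add: N_def c_def)
    also have "\<dots> = (l * X h0 (u A) + m * X h1 (u A)) * (ev e \<epsilon>0 + ev e \<epsilon>1) / 2"
      using NuG[OF steer(1) u_hom u_hom e uq(1) uq(1)] NuG[OF steer(2) u_hom u_hom e uq(1) uq(1)]
      by (simp add: field_simps)
    finally have "c (e \<otimes> u F) = (ev e \<epsilon>0 + ev e \<epsilon>1) / 2" using Xsteer[OF u_hom] uq(1) by simp
    moreover have "N h a1 a2 (e \<otimes> u F) = k * c (e \<otimes> u F)"
      using evs[OF ha cu[OF e]] k ev\<epsilon>[OF cu[OF e]] pure_hom[OF p\<epsilon>] cu[OF e]
      by (simp add: ev_scale_right[of _ ?G] hom_span)
    ultimately show ?thesis using NuG[OF h ha e sharp1] by simp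
  qed
  obtain e where e: "e \<in> hom E I" "ev e \<epsilon>0 \<noteq> ev e \<epsilon>1" using separating_effect[OF \<epsilon>] .
  have "X h a1 + X h a2 = 2 * k" using flag[OF u_hom] uq by simp
  then have "(X h a1 - X h a2) * (ev e \<epsilon>0 - ev e \<epsilon>1) = 0" using flag[OF e(1)] by algebra
  then show ?thesis using e(2) by (simp add: X_def)
qed

lemma sharp_effect_unique:
  assumes a: "pure T A I a1" "pure T A I a2" and \<alpha>: "\<alpha> \<in> nst A" and sharp1: "ev a1 \<alpha> = 1" "ev a2 \<alpha> = 1"
  shows "a1 = a2"
proof (rule effect_eqI[OF pure_hom[OF a(1)] pure_hom[OF a(2)]])
  fix R0 \<Gamma>0 r
  assume \<Gamma>0: "\<Gamma>0 \<in> nst (A \<star> R0)" and r: "r \<in> hom R0 I"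
  note ha = pure_hom[OF a(1)] pure_hom[OF a(2)]
  have p\<alpha>: "pure T I A \<alpha>" using sharp_state_pure[OF a(1) nst_hom[OF \<alpha>] sharp1(1)] .
  note h\<alpha> = nst_hom[OF \<alpha>] and h\<Gamma>0 = nst_hom[OF \<Gamma>0]
  show "ev (a1 \<otimes> r) \<Gamma>0 = ev (a2 \<otimes> r) \<Gamma>0"
  proof (cases "\<exists>\<epsilon>\<in>nst A. \<epsilon> \<noteq> \<alpha>")
    case False
    have "(idn A \<otimes> u R0) \<odot> \<Gamma>0 \<in> nst A"
      using channel_apply_nst[OF channel_par[OF ident_channel[of A] det_eff_channel[of R0]] \<Gamma>0] by simp
    then have m: "(idn A \<otimes> u R0) \<odot> \<Gamma>0 = \<alpha>" using False by blast
    obtain k where k: "(idn A \<otimes> r) \<odot> \<Gamma>0 = k *\<^sub>R \<alpha>"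
      using pure_marginal_contract[OF h\<Gamma>0 _ r] p\<alpha> unfolding m by blast
    have "ev (b \<otimes> r) \<Gamma>0 = k * ev b \<alpha>" if b: "b \<in> hom A I" for b
      using ev_contract_right[OF h\<Gamma>0 r b] k b h\<alpha> by (simp add: ev_scale_right[of _ A] hom_span)
    then show ?thesis using ha sharp1 by simp
  next
    case True
    then obtain \<epsilon> where \<epsilon>: "\<epsilon> \<in> nst A" "\<alpha> \<noteq> \<epsilon>" by blast
    note h\<epsilon> = nst_hom[OF \<epsilon>(1)]
    obtain \<rho>0 where \<rho>0: "\<rho>0 \<in> nst R0" using nst_exists by blast
    note h\<rho>0 = nst_hom[OF \<rho>0]
    obtain c where c: "c \<in> hom A I" "ev c \<alpha> \<noteq> ev c \<epsilon>" using separating_effect[OF \<alpha> \<epsilon>] .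
    have n1: "(\<alpha> \<otimes> \<rho>0) \<otimes> \<alpha> \<in> nst (A \<star> R0 \<star> A)" using nst_par[OF nst_par[OF \<alpha> \<rho>0] \<alpha>] by simp
    have n2: "\<Gamma>0 \<otimes> \<epsilon> \<in> nst (A \<star> R0 \<star> A)" using nst_par[OF \<Gamma>0 \<epsilon>(1)] by simp
    obtain R1 \<Gamma> where \<Gamma>: "pure T I ((A \<star> R0 \<star> A) \<star> R1) \<Gamma>" "\<Gamma> \<in> nst ((A \<star> R0 \<star> A) \<star> R1)"
      "(idn (A \<star> R0 \<star> A) \<otimes> u R1) \<odot> \<Gamma> = (1/2) *\<^sub>R ((\<alpha> \<otimes> \<rho>0) \<otimes> \<alpha>) + (1/2) *\<^sub>R (\<Gamma>0 \<otimes> \<epsilon>)"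
      using purification_exists[OF nst_half[OF n1 n2]] .
    let ?R = "R0 \<star> A \<star> R1"
    let ?\<Gamma>s = "swap T A ?R \<odot> \<Gamma>"
    have \<Gamma>': "pure T I (A \<star> ?R) \<Gamma>" "\<Gamma> \<in> nst (A \<star> ?R)" using \<Gamma>(1,2) by simp_all
    note \<Gamma>s = pure_swap[OF \<Gamma>'(1)] nst_swap[OF \<Gamma>'(2)]
    define H where "H r e = r \<otimes> (e \<otimes> u R1)" for r e
    have hH: "H r e \<in> hom ?R I" if "r \<in> hom R0 I" "e \<in> hom A I" for r e
      using that by (simp add: H_def par_effect)
    have ev\<Gamma>: "ev (H r e \<otimes> b) ?\<Gamma>s = (ev b \<alpha> * ev r \<rho>0 * ev e \<alpha> + ev (b \<otimes> r) \<Gamma>0 * ev e \<epsilon>) / 2"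
      if r: "r \<in> hom R0 I" and e: "e \<in> hom A I" and b: "b \<in> hom A I" for r e b
    proof -
      have br: "b \<otimes> r \<in> hom (A \<star> R0) I" using b r by (rule par_effect)
      have bre: "(b \<otimes> r) \<otimes> e \<in> hom (A \<star> R0 \<star> A) I" using par_effect[OF br e] by simp
      have "ev (H r e \<otimes> b) ?\<Gamma>s = ev (b \<otimes> H r e) \<Gamma>" using ev_swap[OF b hH[OF r e] nst_hom[OF \<Gamma>'(2)]] .
      also have "b \<otimes> H r e = ((b \<otimes> r) \<otimes> e) \<otimes> u R1"
        using par_assoc[OF b r par_effect[OF e u_hom[of R1]]] par_assoc[OF br e u_hom[of R1]] by (simp add: H_def)
      also have "ev \<dots> \<Gamma> = ev ((b \<otimes> r) \<otimes> e) ((1/2) *\<^sub>R ((\<alpha> \<otimes> \<rho>0) \<otimes> \<alpha>) + (1/2) *\<^sub>R (\<Gamma>0 \<otimes> \<epsilon>))"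
        using ev_contract_right[OF nst_hom[OF \<Gamma>(2)] u_hom bre] \<Gamma>(3) by simp
      also have "\<dots> = (ev ((b \<otimes> r) \<otimes> e) ((\<alpha> \<otimes> \<rho>0) \<otimes> \<alpha>) + ev ((b \<otimes> r) \<otimes> e) (\<Gamma>0 \<otimes> \<epsilon>)) / 2"
        using ev_half[OF bre nst_hom[OF n1] nst_hom[OF n2]] .
      also have "\<dots> = (ev b \<alpha> * ev r \<rho>0 * ev e \<alpha> + ev (b \<otimes> r) \<Gamma>0 * ev e \<epsilon>) / 2"
        using ev_par[OF br e par_state[OF h\<alpha> h\<rho>0] h\<alpha>] ev_par[OF b r h\<alpha> h\<rho>0] ev_par[OF br e h\<Gamma>0 h\<epsilon>] by simp
      finally show ?thesis .
    qed
    note us = nst_u[OF \<alpha>] nst_u[OF \<rho>0] nst_u[OF \<epsilon>(1)]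
    define d where "d = ev c \<alpha> - ev c \<epsilon>"
    have d: "d \<noteq> 0" using c(2) by (simp add: d_def)
    have "(2 / d) * ev (H (u R0) c \<otimes> b) ?\<Gamma>s + (- 2 * ev c \<epsilon> / d) * ev (H (u R0) (u A) \<otimes> b) ?\<Gamma>s = ev b \<alpha>"
      if b: "b \<in> hom A I" for b
    proof -
      have x: "ev (H (u R0) c \<otimes> b) ?\<Gamma>s = (ev b \<alpha> * ev c \<alpha> + ev (b \<otimes> u R0) \<Gamma>0 * ev c \<epsilon>) / 2"
        and y: "ev (H (u R0) (u A) \<otimes> b) ?\<Gamma>s = (ev b \<alpha> + ev (b \<otimes> u R0) \<Gamma>0) / 2"
        using ev\<Gamma>[OF u_hom c(1) b] ev\<Gamma>[OF u_hom u_hom b] us by simp_all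
      have "(2 / d) * ev (H (u R0) c \<otimes> b) ?\<Gamma>s + (- 2 * ev c \<epsilon> / d) * ev (H (u R0) (u A) \<otimes> b) ?\<Gamma>s
          = (2 * ev (H (u R0) c \<otimes> b) ?\<Gamma>s - 2 * ev c \<epsilon> * ev (H (u R0) (u A) \<otimes> b) ?\<Gamma>s) / d"
        by (simp add: diff_divide_distrib)
      also have "\<dots> = (d * ev b \<alpha>) / d"
        unfolding x y by (simp add: d_def algebra_simps add_divide_distrib)
      finally have "(2 / d) * ev (H (u R0) c \<otimes> b) ?\<Gamma>s + (- 2 * ev c \<epsilon> / d) * ev (H (u R0) (u A) \<otimes> b) ?\<Gamma>s
          = (d * ev b \<alpha>) / d" .
      then show ?thesis using d by simp
    qed
    from sharp_effects_agree[OF a p\<alpha> \<alpha> sharp1 \<alpha> \<epsilon> \<Gamma>s hH[OF u_hom c(1)] hH[OF u_hom u_hom] this hH[OF r u_hom]]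
    show ?thesis using ev\<Gamma>[OF r u_hom ha(1)] ev\<Gamma>[OF r u_hom ha(2)] us sharp1 by simp
  qed
qed

lemma normalized_effect_attained:
  assumes a: "a \<in> normalized_effects T A"
  obtains \<alpha> where "\<alpha> \<in> nst A" "ev a \<alpha> = 1"
proof -
  have ha: "a \<in> hom A I" and sup: "(SUP \<rho>\<in>nst A. ev a \<rho>) = 1" using a by (auto simp: normalized_effects_def)
  have comp: "compact (hom I A)" using hom_convex_compact by blast
  obtain S where S: "finite S" "hom I A \<subseteq> span S" using hom_convex_compact by blast
  obtain B where B: "B \<subseteq> hom I A" "independent B" "hom I A \<subseteq> span B"
    using maximal_independent_subset by blast
  have fin: "finite B" using independent_span_bound[OF S(1) B(2)] B(1) S(2) by blast
  have sp: "span B = span (hom I A)" using span_mono[OF B(1)] span_minimal[OF B(3) subspace_span] by (rule antisym)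
  have cont: "continuous_on (hom I A) (ev e)" if e: "e \<in> hom A I" for e
  proof -
    have add: "ev e (x + y) = ev e x + ev e y" if "x \<in> span B" "y \<in> span B" for x y
      using that e unfolding sp by (simp add: ev_add_right[of _ A] hom_span)
    have scale: "ev e (k *\<^sub>R x) = k * ev e x" if "x \<in> span B" for k x
      using that e unfolding sp by (simp add: ev_scale_right[of _ A] hom_span)
    obtain C where C: "C \<ge> 0" "\<And>x. x \<in> span B \<Longrightarrow> \<bar>ev e x\<bar> \<le> C * norm x"
      using linear_functional_bounded_on_finite_span[OF fin add scale] by blast
    have "C-lipschitz_on (hom I A) (ev e)"
    proof (rule lipschitz_onI[OF _ C(1)])
      fix x y assume xy: "x \<in> hom I A" "y \<in> hom I A"
      then have xy': "x \<in> span B" "y \<in> span B" using B(3) by auto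
      have "ev e (x - y) = ev e x - ev e y"
        using add[OF xy'(1) span_scale[OF xy'(2), of "-1"]] scale[OF xy'(2), of "-1"] by simp
      then show "dist (ev e x) (ev e y) \<le> C * dist x y"
        using C(2)[OF span_diff[OF xy']] by (simp add: dist_norm)
    qed
    then show ?thesis by (rule lipschitz_on_continuous_on)
  qed
  have "nst A = hom I A \<inter> {\<rho> \<in> hom I A. ev (u A) \<rho> = 1}" by (auto simp: nst_iff)
  moreover have "closed {\<rho> \<in> hom I A. ev (u A) \<rho> = 1}"
    using continuous_closed_preimage_constant[OF cont[OF u_hom] compact_imp_closed[OF comp]] .
  ultimately have "compact (nst A)" using compact_Int_closed[OF comp] by simp
  moreover have "continuous_on (nst A) (ev a)"
    using continuous_on_subset[OF cont[OF ha]] nst_hom by blast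
  ultimately obtain \<alpha> where \<alpha>: "\<alpha> \<in> nst A" "\<And>\<rho>. \<rho> \<in> nst A \<Longrightarrow> ev a \<rho> \<le> ev a \<alpha>"
    using continuous_attains_sup[of "nst A" "ev a"] nst_exists by blast
  have "(SUP \<rho>\<in>nst A. ev a \<rho>) = ev a \<alpha>"
    using \<alpha> by (intro cSup_eq_maximum) auto
  then show thesis using that \<alpha>(1) sup by simp
qed

lemma sharp_normalized_effect:
  assumes "a \<in> hom A I" "\<alpha> \<in> nst A" "ev a \<alpha> = 1"
  shows "a \<in> normalized_effects T A"
proof -
  have "(SUP \<rho>\<in>nst A. ev a \<rho>) = 1"
    using assms ev_bounds(2)[OF assms(1)] nst_hom by (intro cSup_eq_maximum) (auto intro!: rev_image_eqI)
  then show ?thesis using assms(1) by (simp add: normalized_effects_def)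
qed

lemma state_effect_duality:
  "\<exists>dag. bij_betw dag (pure_normalized_states T A) (pure_normalized_effects T A) \<and>
     (\<forall>\<alpha>\<in>pure_normalized_states T A. ev (dag \<alpha>) \<alpha> = 1)"
proof -
  let ?S = "pure_normalized_states T A" and ?E = "pure_normalized_effects T A"
  have "\<exists>a. pure T A I a \<and> ev a \<alpha> = 1" if "\<alpha> \<in> ?S" for \<alpha>
    using that sharp_effect_exists[of A \<alpha>] unfolding pure_normalized_states_def by blast
  then obtain dag where dag: "\<And>\<alpha>. \<alpha> \<in> ?S \<Longrightarrow> pure T A I (dag \<alpha>)" "\<And>\<alpha>. \<alpha> \<in> ?S \<Longrightarrow> ev (dag \<alpha>) \<alpha> = 1"
    by metis
  have S: "\<alpha> \<in> nst A" "pure T I A \<alpha>" if "\<alpha> \<in> ?S" for \<alpha> using that by (auto simp: pure_normalized_states_def)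
  have "bij_betw dag ?S ?E"
  proof (rule bij_betw_imageI)
    show "inj_on dag ?S"
    proof (rule inj_onI)
      fix \<alpha> \<beta> assume *: "\<alpha> \<in> ?S" "\<beta> \<in> ?S" "dag \<alpha> = dag \<beta>"
      then show "\<alpha> = \<beta>"
        using sharp_state_unique[OF dag(1)[OF *(1)] nst_hom[OF S(1)[OF *(1)]] dag(2)[OF *(1)] nst_hom[OF S(1)[OF *(2)]]]
          dag(2)[OF *(2)] by simp
    qed
    show "dag ` ?S = ?E"
    proof
      show "dag ` ?S \<subseteq> ?E"
        using sharp_normalized_effect[OF pure_hom[OF dag(1)] S(1) dag(2)] dag(1)
        by (auto simp: pure_normalized_effects_def)
      show "?E \<subseteq> dag ` ?S"
      proof
        fix a assume "a \<in> ?E"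
        then have a: "a \<in> normalized_effects T A" "pure T A I a" by (auto simp: pure_normalized_effects_def)
        obtain \<alpha> where \<alpha>: "\<alpha> \<in> nst A" "ev a \<alpha> = 1" using normalized_effect_attained[OF a(1)] .
        have "\<alpha> \<in> ?S"
          using \<alpha> sharp_state_pure[OF a(2) nst_hom[OF \<alpha>(1)] \<alpha>(2)] by (simp add: pure_normalized_states_def)
        moreover from this have "a = dag \<alpha>" using sharp_effect_unique[OF a(2) dag(1) \<alpha>(1,2) dag(2)] by blast
        ultimately show "a \<in> dag ` ?S" by blast
      qed
    qed
  qed
  with dag(2) show ?thesis by blast
qed

end

theorem theorem3:
  fixes T :: "('s, 't::real_normed_vector) opt" and A :: 's
  assumes "sharp_theory_with_purification T"
  shows "\<exists>dag. bij_betw dag (pure_normalized_states T A) (pure_normalized_effects T A) \<and>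
           (\<forall>\<alpha> \<in> pure_normalized_states T A. pr T (dag \<alpha>) \<alpha> = 1)"
proof -
  interpret sharp_purification_theory T by unfold_locales (rule assms)
  show ?thesis by (rule state_effect_duality)
qed

end
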